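(* Let $G$ be an outerplanar graph with $n \geq 4$ vertices. Then \[ \gamma_{s}(G) \geq \frac{n+4}{5}. \] Moreover, the bound is tight: for every integer $k \geq 2$ there exists an outerplanar graph $G$ with $n = 5k+1$ vertices such that $\gamma_{s}(G) = \frac{n+4}{5} = k+1$.
   Context: All graphs are finite, simple and undirected. A graph is outerplanar if it has a crossing-free embedding in the plane such that all vertices lie on the boundary of the outer (unbounded) face. A set $S \subseteq V(G)$ is a dominating set if every vertex not in $S$ is adjacent to some vertex of $S$. A dominating set $S$ is a secure dominating set if for every vertex $u \in V(G)\setminus S$ there exists a vertex $v \in S$ with $uv \in E(G)$ such that $(S \setminus \{v\}) \cup \{u\}$ is also a dominating set of $G$. The secure domination number $\gamma_{s}(G)$ is the minimum cardinality of a secure dominating set of $G$. *)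

theory Defs
  imports "HOL-Analysis.Analysis" "Graph_Theory.Pair_Digraph"
begin

text \<open>
  A finite simple undirected graph is a \<open>pair_graph\<close>: finite, loop-free, and with a symmetric
  set of arcs, so that every undirected edge \<open>uv\<close> occurs as the two arcs \<open>(u, v)\<close> and \<open>(v, u)\<close>.
  A plane drawing assigns one curve to each undirected edge, hence \<open>uedges\<close>.
\<close>

definition uedges :: "'a pair_pre_digraph \<Rightarrow> 'a set set" where
  "uedges G = {{u, v} | u v. (u, v) \<in> parcs G}"

text \<open>
  The plane is \<^typ>\<open>complex\<close>, where the library states the Jordan curve theorem. The vertex \<open>v\<close>
  is drawn as the point \<open>p v\<close> and the edge \<open>e\<close> as the arc (injective path) \<open>c e\<close>, which may be
  traversed in either direction.
\<close>

definition plane_embedding ::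
    "'a pair_pre_digraph \<Rightarrow> ('a \<Rightarrow> complex) \<Rightarrow> ('a set \<Rightarrow> real \<Rightarrow> complex) \<Rightarrow> bool" where
  "plane_embedding G p c \<longleftrightarrow>
     inj_on p (pverts G) \<and>
     (\<forall>e\<in>uedges G.
        arc (c e) \<and>
        {pathstart (c e), pathfinish (c e)} = p ` e \<and>
        path_image (c e) \<inter> p ` pverts G = p ` e) \<and>
     (\<forall>e\<in>uedges G. \<forall>f\<in>uedges G. e \<noteq> f \<longrightarrow>
        path_image (c e) \<inter> path_image (c f) \<subseteq> p ` (e \<inter> f))"

definition drawing ::
    "'a pair_pre_digraph \<Rightarrow> ('a \<Rightarrow> complex) \<Rightarrow> ('a set \<Rightarrow> real \<Rightarrow> complex) \<Rightarrow> complex set" where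
  "drawing G p c = p ` pverts G \<union> (\<Union>e\<in>uedges G. path_image (c e))"

text \<open>
  For a finite graph the drawing is compact, so its complement has exactly one unbounded
  component, namely \<open>outside (drawing G p c)\<close>: this is the outer face.
\<close>

definition outerplanar :: "'a pair_pre_digraph \<Rightarrow> bool" where
  "outerplanar G \<longleftrightarrow>
     (\<exists>p c. plane_embedding G p c \<and> p ` pverts G \<subseteq> frontier (outside (drawing G p c)))"

definition dominating_set :: "'a pair_pre_digraph \<Rightarrow> 'a set \<Rightarrow> bool" where
  "dominating_set G S \<longleftrightarrow>
     S \<subseteq> pverts G \<and> (\<forall>u\<in>pverts G - S. \<exists>v\<in>S. (u, v) \<in> parcs G)"

definition secure_dominating_set :: "'a pair_pre_digraph \<Rightarrow> 'a set \<Rightarrow> bool" where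
  "secure_dominating_set G S \<longleftrightarrow>
     dominating_set G S \<and>
     (\<forall>u\<in>pverts G - S. \<exists>v\<in>S. (u, v) \<in> parcs G \<and> dominating_set G ((S - {v}) \<union> {u}))"

text \<open>
  The minimum is over a finite nonempty set whenever \<open>pverts G\<close> is finite, since \<open>pverts G\<close> is
  itself a secure dominating set.
\<close>

definition secure_domination_number :: "'a pair_pre_digraph \<Rightarrow> nat" where
  "secure_domination_number G = Min (card ` {S. secure_dominating_set G S})"

end

theory Submission
  imports Defs
begin

text \<open>
  Let \<open>S\<close> be a secure dominating set with \<open>k\<close> elements, \<open>A\<close> the set of vertices outside \<open>S\<close> with
  exactly one neighbour in \<open>S\<close>, and \<open>B\<close> the set of the remaining vertices outside \<open>S\<close>. The external
  private neighbours of \<open>v \<in> S\<close> form a clique together with \<open>v\<close>, so there are at most two of them, as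
  an outerplanar graph has no \<open>K\<^sub>4\<close>. In an outerplanar graph \<open>\<bar>B\<bar> \<le> 2k - 2\<close>: two disjoint connected
  subgraphs have at most two common neighbours (otherwise a theta curve encloses one of them), so one
  can contract paths \<open>s - b - t\<close> with \<open>b \<in> B\<close> one after the other. This gives \<open>n \<le> 5k - 4\<close> if
  \<open>\<bar>A\<bar> \<le> 2k - 2\<close>. Otherwise all of \<open>S\<close> except at most one vertex \<open>v\<close> have two private neighbours; a vertex
  with two private neighbours cannot defend an element of \<open>B\<close> without creating a \<open>K\<^sub>4\<close>, so \<open>B\<close> consists
  of common neighbours of \<open>v\<close> and its only private neighbour, of which there are at most two.
\<close>

section \<open>Theta curves with marked points on the outer boundary\<close>

text \<open>Joining \<open>c1\<close> with the reverse of \<open>c2\<close> gives a simple closed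
  curve, to which the Jordan curve theorem applies; later arguments can then speak of the two arcs
  alone.\<close>

lemma Jordan_two_arcs:
  fixes c1 c2 :: "real \<Rightarrow> complex"
  assumes "arc c1" "arc c2"
    and "pathstart c1 = a" "pathfinish c1 = b" "pathstart c2 = a" "pathfinish c2 = b"
    and "path_image c1 \<inter> path_image c2 \<subseteq> {a, b}"
  defines "C \<equiv> path_image c1 \<union> path_image c2"
  shows "inside C \<noteq> {}" "connected (inside C)" "connected (outside C)"
    "frontier (inside C) = C" "inside C \<union> outside C = - C"
proof -
  let ?l = "c1 +++ reversepath c2"
  have l: "simple_path ?l" "pathfinish ?l = pathstart ?l" "path_image ?l = C"
    using assms by (auto intro!: simple_path_join_loop simp: arc_reversepath path_image_join)
  show "inside C \<noteq> {}" "connected (inside C)" "connected (outside C)"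
    "frontier (inside C) = C" "inside C \<union> outside C = - C"
    using Jordan_inside_outside [OF l(1,2)] unfolding l(3) by auto
qed

text \<open>Without its ends the arc is connected and avoids \<open>C\<close>, so it lies in one
  component of \<open>- C\<close>, and \<open>m\<close> shows that this component is not an inside
  one.\<close>

lemma arc_interior_misses_inside:
  fixes c :: "real \<Rightarrow> complex"
  assumes "arc c" "pathstart c = a" "pathfinish c = b" "closed C" "path_image c \<inter> C \<subseteq> {a, b}"
    and "m \<in> path_image c - {a, b}" "m \<notin> inside C" "{a, b} \<subseteq> C"
  shows "path_image c \<inter> inside C = {}"
proof (rule ccontr)
  assume "\<not> ?thesis"
  then obtain x where x: "x \<in> path_image c" "x \<in> inside C"
    by blast
  then have "x \<in> path_image c - {a, b}"
    using assms(8) inside_no_overlap [of C] by blast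
  moreover have "connected (path_image c - {a, b})"
    using connected_simple_path_endless [of c] assms by (simp add: arc_imp_simple_path)
  moreover have "path_image c - {a, b} \<subseteq> - C"
    using assms by blast
  ultimately have "connected_component (- C) x m"
    using assms(6) unfolding connected_component_def by blast
  then show False
    using inside_same_component x assms by blast
qed

text \<open>
  If the third arc left the Jordan domain of the other two, that domain would be separated from
  infinity by \<open>c1 \<union> c2\<close>, but neither by \<open>c1 \<union> c3\<close> nor by \<open>c2 \<union> c3\<close>; since these two sets meet in
  the connected set \<open>c3\<close>, this contradicts Janiszewski's theorem.
\<close>

lemma theta_marked_arcs:
  fixes c1 c2 c3 :: "real \<Rightarrow> complex"
  assumes arcs: "arc c1" "arc c2" "arc c3"
    and ends: "pathstart c1 = a" "pathfinish c1 = b" "pathstart c2 = a" "pathfinish c2 = b"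
      "pathstart c3 = a" "pathfinish c3 = b"
    and int: "path_image c1 \<inter> path_image c2 \<subseteq> {a, b}" "path_image c1 \<inter> path_image c3 \<subseteq> {a, b}"
      "path_image c2 \<inter> path_image c3 \<subseteq> {a, b}"
    and m: "m1 \<in> path_image c1 - {a, b}" "m2 \<in> path_image c2 - {a, b}"
    and nin: "m1 \<notin> inside (path_image c2 \<union> path_image c3)"
      "m2 \<notin> inside (path_image c1 \<union> path_image c3)"
  shows "path_image c3 - {a, b} \<subseteq> inside (path_image c1 \<union> path_image c2)"
proof (rule ccontr)
  let ?C12 = "path_image c1 \<union> path_image c2" and ?C13 = "path_image c1 \<union> path_image c3"
    and ?C23 = "path_image c2 \<union> path_image c3"
  assume "\<not> ?thesis"
  then obtain m3 where m3: "m3 \<in> path_image c3 - {a, b}" "m3 \<notin> inside ?C12"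
    by blast
  have ab: "{a, b} \<subseteq> path_image c1" "{a, b} \<subseteq> path_image c2" "{a, b} \<subseteq> path_image c3"
    using ends pathstart_in_path_image pathfinish_in_path_image by (metis empty_subsetI insert_subset)+
  have cl: "closed (path_image c1)" "closed (path_image c2)" "closed (path_image c3)"
    using arcs by (auto simp: closed_arc_image)
  have miss3: "path_image c3 \<inter> inside ?C12 = {}"
  proof (rule arc_interior_misses_inside)
    show "path_image c3 \<inter> ?C12 \<subseteq> {a, b}"
      using int by blast
    show "{a, b} \<subseteq> ?C12"
      using ab by blast
  qed (use arcs ends m3 cl in auto)
  note J12 = Jordan_two_arcs [OF arcs(1,2) ends(1-4) int(1)]
  note J13 = Jordan_two_arcs [OF arcs(1,3) ends(1,2,5,6) int(2)]
  note J23 = Jordan_two_arcs [OF arcs(2,3) ends(3-6) int(3)]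
  from J12(1) obtain x where x: "x \<in> inside ?C12"
    by blast
  \<comment> \<open>\<open>x\<close> stands for the whole connected domain of \<open>?C12\<close>:
    if \<open>inside C\<close> contained \<open>x\<close>, it would contain that domain, and
    \<open>C \<union> inside C\<close> would contain its boundary \<open>?C12\<close>, hence
    \<open>m\<close>.\<close>
  have *: "x \<notin> inside C" if C: "C \<inter> inside ?C12 = {}" "closed C"
    "m \<in> ?C12" "m \<notin> C" "m \<notin> inside C" for C m
  proof
    assume "x \<in> inside C"
    have "inside ?C12 \<subseteq> inside C"
    proof
      fix y assume "y \<in> inside ?C12"
      then have "connected_component (- C) x y"
        using x C(1) J12(2) unfolding connected_component_def by blast
      then show "y \<in> inside C"
        using \<open>x \<in> inside C\<close> inside_same_component by blast
    qed
    moreover have "m \<in> closure (inside ?C12)"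
      using J12(4) C(3) by (auto simp: frontier_def)
    ultimately have "m \<in> C \<union> inside C"
      using closure_inside_subset [OF C(2)] closure_mono by blast
    then show False
      using C by blast
  qed
  have "?C13 \<inter> inside ?C12 = {}" "?C23 \<inter> inside ?C12 = {}"
    using miss3 inside_no_overlap [of ?C12] by blast+
  moreover have "m2 \<notin> ?C13" "m1 \<notin> ?C23"
    using m int by blast+
  ultimately have "x \<notin> inside ?C13" "x \<notin> inside ?C23"
    using *[of ?C13 m2] *[of ?C23 m1] m nin cl by (simp_all add: closed_Un)
  moreover have "x \<notin> ?C13" "x \<notin> ?C23"
    using x miss3 inside_no_overlap [of ?C12] by blast+
  ultimately have xo: "x \<in> outside ?C13" "x \<in> outside ?C23"
    using J13(5) J23(5) by blast+
  \<comment> \<open>A point beyond a disc around all three arcs serves as infinity: it is outside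
    each of the cycles.\<close>
  obtain r where r: "path_image c1 \<union> path_image c2 \<union> path_image c3 \<subseteq> ball 0 r"
    using arcs by (meson bounded_Un bounded_arc_image bounded_subset_ballD)
  obtain z where "z \<notin> ball (0::complex) r"
    using that [of "complex_of_real \<bar>r\<bar>"] by (simp add: dist_norm)
  then have z: "z \<in> outside C" if "C \<subseteq> ball 0 r" for C
    using that outside_subset_convex [OF convex_ball] by blast
  have con: "connected_component (- C) x z"
    if "C \<subseteq> ball 0 r" "x \<in> outside C" "connected (outside C)" for C
    unfolding connected_component_def
  proof (intro exI conjI)
    show "outside C \<subseteq> - C"
      using outside_no_overlap [of C] by blast
  qed (use that z in auto)
  have "?C13 \<subseteq> ball 0 r" "?C23 \<subseteq> ball 0 r"
    using r by blast+
  then have "connected_component (- ?C13) x z" "connected_component (- ?C23) x z"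
    using con xo J13(3) J23(3) by blast+
  \<comment> \<open>The two cycles share exactly the image of \<open>c3\<close>, which is connected,
    as Janiszewski's theorem requires.\<close>
  moreover have "path_image c1 \<inter> path_image c2 \<subseteq> path_image c3"
    using int(1) ab(3) by (rule order_trans)
  then have "?C13 \<inter> ?C23 = path_image c3"
    by blast
  ultimately have "connected_component (- (?C13 \<union> ?C23)) x z"
    using Janiszewski [of ?C13 ?C23 x z] arcs
    by (simp add: compact_Un compact_arc_image connected_arc_image closed_Un closed_arc_image)
  then have "connected_component (- ?C12) x z"
    by (rule connected_component_of_subset) blast
  then have "z \<in> inside ?C12"
    using x inside_same_component by blast
  then show False
    using z [of ?C12] r inside_Int_outside [of ?C12] by blast
qed

section \<open>Splitting arcs and shrinking continua to tripods\<close>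

lemma arc_split:
  fixes g :: "real \<Rightarrow> 'a::real_normed_vector"
  assumes "arc g" "m \<in> path_image g" "m \<noteq> pathstart g" "m \<noteq> pathfinish g"
  obtains e f where "arc e" "pathstart e = pathstart g" "pathfinish e = m"
    "arc f" "pathstart f = pathfinish g" "pathfinish f = m"
    "path_image e \<union> path_image f = path_image g" "path_image e \<inter> path_image f = {m}"
proof -
  from assms(2) obtain t where t: "0 \<le> t" "t \<le> 1" "m = g t"
    by (auto simp: path_image_def)
  then have t01: "t \<noteq> 0" "t \<noteq> 1"
    using assms by (auto simp: pathstart_def pathfinish_def)
  have inj: "inj_on g {0..1}"
    using assms by (simp add: arc_def)
  show thesis
  proof
    \<comment> \<open>Both pieces run towards \<open>m\<close>, hence \<open>subpath 1 t\<close> for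
      the second; the legs of a tripod are supplied in this orientation.\<close>
    show "arc (subpath 0 t g)" "arc (subpath 1 t g)"
      using t t01 assms by (auto intro: arc_subpath_arc)
    show "path_image (subpath 0 t g) \<union> path_image (subpath 1 t g) = path_image g"
      using t by (force simp: path_image_subpath path_image_def [of g])
    show "path_image (subpath 0 t g) \<inter> path_image (subpath 1 t g) = {m}"
    proof -
      have "{0..t} \<inter> {t..1} = {t}"
        using t by auto
      then have "g ` {0..t} \<inter> g ` {t..1} = {g t}"
        using t inj_on_image_Int [OF inj, of "{0..t}" "{t..1}"] by auto
      then show ?thesis
        using t by (simp add: path_image_subpath)
    qed
  qed (use t in \<open>auto simp: pathstart_def pathfinish_def subpath_def\<close>)
qed

text \<open>An arc between the far ends of \<open>e1\<close> and \<open>e2\<close> forms two legs.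
  It must pass through \<open>X\<close>, so it can be reached from the far end of \<open>e3\<close>
  within \<open>X\<close> and \<open>e3\<close>; cutting that path at the first contact
  \<open>u\<close> gives the third leg.\<close>

lemma tripod:
  fixes X :: "'a::{complete_space,real_normed_vector} set"
  assumes X: "closed X" "path_connected X"
    and e: "path e1" "path e2" "path e3" "pathstart e1 \<in> X" "pathstart e2 \<in> X" "pathstart e3 \<in> X"
      "pathfinish e1 \<notin> X" "pathfinish e2 \<notin> X" "pathfinish e3 \<notin> X"
    and int: "path_image e1 \<inter> path_image e2 \<subseteq> X" "path_image e1 \<inter> path_image e3 \<subseteq> X"
      "path_image e2 \<inter> path_image e3 \<subseteq> X"
  obtains u h1 h2 h3 where "arc h1" "arc h2" "arc h3"
    "pathstart h1 = u" "pathstart h2 = u" "pathstart h3 = u"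
    "pathfinish h1 = pathfinish e1" "pathfinish h2 = pathfinish e2" "pathfinish h3 = pathfinish e3"
    "path_image h1 \<union> path_image h2 \<union> path_image h3 \<subseteq> X \<union> path_image e1 \<union> path_image e2 \<union> path_image e3"
    "path_image h1 \<inter> path_image h2 \<subseteq> {u}" "path_image h1 \<inter> path_image h3 \<subseteq> {u}"
    "path_image h2 \<inter> path_image h3 \<subseteq> {u}"
proof -
  define m1 m2 m3 where m_def: "m1 = pathfinish e1" "m2 = pathfinish e2" "m3 = pathfinish e3"
  have me: "m1 \<in> path_image e1" "m2 \<in> path_image e2" "m3 \<in> path_image e3"
    by (auto simp: m_def)
  have mX: "m1 \<notin> X" "m2 \<notin> X" "m3 \<notin> X"
    using e by (simp_all add: m_def)
  have mne: "m1 \<notin> path_image e2" "m1 \<notin> path_image e3" "m2 \<notin> path_image e1"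
    "m2 \<notin> path_image e3" "m3 \<notin> path_image e1" "m3 \<notin> path_image e2"
    using me mX int by blast+
  have pcX: "path_connected (X \<union> path_image p)" if "path p" "pathstart p \<in> X" for p
    using that X by (intro path_connected_Un path_connected_path_image) auto
  have "path_connected ((X \<union> path_image e1) \<union> path_image e2)"
    using e by (intro path_connected_Un pcX path_connected_path_image) auto
  moreover have "m1 \<noteq> m2"
    using me mne by blast
  ultimately obtain \<gamma> where \<gamma>: "arc \<gamma>" "path_image \<gamma> \<subseteq> X \<union> path_image e1 \<union> path_image e2"
    "pathstart \<gamma> = m1" "pathfinish \<gamma> = m2"
    using me unfolding path_connected_arcwise by blast
  have cl\<gamma>: "closed (path_image \<gamma>)"
    using \<gamma> by (simp add: closed_arc_image)
  have m3\<gamma>: "m3 \<notin> path_image \<gamma>"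
    using \<gamma>(2) mX mne by blast
  \<comment> \<open>Off \<open>X\<close> the images of \<open>e1\<close> and \<open>e2\<close> are
    disjoint closed sets, so a connected \<open>\<gamma>\<close> missing \<open>X\<close> could not
    meet both.\<close>
  have "path_image \<gamma> \<inter> X \<noteq> {}"
  proof
    assume *: "path_image \<gamma> \<inter> X = {}"
    have "connected (path_image \<gamma>)" "closed (path_image e1)" "closed (path_image e2)"
      using \<gamma>(1) e by (auto simp: connected_arc_image closed_path_image)
    moreover have "m1 \<in> path_image e1 \<inter> path_image \<gamma>" "m2 \<in> path_image e2 \<inter> path_image \<gamma>"
      using me \<gamma> by auto
    moreover have "path_image \<gamma> \<subseteq> path_image e1 \<union> path_image e2"
      "path_image e1 \<inter> path_image e2 \<inter> path_image \<gamma> = {}"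
      using * \<gamma>(2) int by blast+
    ultimately show False
      unfolding connected_closed by blast
  qed
  then obtain q where q: "q \<in> path_image \<gamma>" "q \<in> X"
    by blast
  from pcX [of e3] e obtain d where d: "path d" "path_image d \<subseteq> X \<union> path_image e3"
    "pathstart d = m3" "pathfinish d = q"
    using q me unfolding path_connected_def by blast
  \<comment> \<open>Leaving the open set \<open>- path_image \<gamma>\<close> for the first time
    means touching \<open>\<gamma>\<close> for the first time.\<close>
  obtain h where h: "path h" "pathstart h = m3" "path_image h \<subseteq> path_image d"
    "path_image h - {pathfinish h} \<subseteq> interior (- path_image \<gamma>)"
    "pathfinish h \<in> frontier (- path_image \<gamma>)"
    using exists_path_subpath_to_frontier [of d "- path_image \<gamma>"] d q m3\<gamma> closure_subset
    by (metis ComplD ComplI subsetD)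
  define u where "u = pathfinish h"
  have u\<gamma>: "u \<in> path_image \<gamma>"
    using h(5) cl\<gamma> frontier_subset_closed unfolding u_def frontier_complement by blast
  have h\<gamma>: "path_image h \<inter> path_image \<gamma> \<subseteq> {u}"
    using h(4) interior_subset unfolding u_def by blast
  have uh: "u \<in> path_image h"
    by (auto simp: u_def)
  then have uX: "u \<in> X \<union> path_image e3"
    using h d by blast
  \<comment> \<open>\<open>u\<close> lies in \<open>X\<close> or on \<open>e3\<close>, where neither
    \<open>m1\<close> nor \<open>m2\<close> can be, so \<open>\<gamma>\<close> is cut at an inner
    point.\<close>
  then have une: "u \<noteq> m1" "u \<noteq> m2" "u \<noteq> m3"
    using mX mne u\<gamma> m3\<gamma> by blast+
  obtain h3 where h3: "arc h3" "path_image h3 \<subseteq> path_image h" "pathstart h3 = u" "pathfinish h3 = m3"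
    using path_connected_path_image [OF h(1)] uh une h(2) pathstart_in_path_image [of h]
    unfolding path_connected_arcwise by metis
  obtain f1 f2 where f: "arc f1" "pathstart f1 = m1" "pathfinish f1 = u"
    "arc f2" "pathstart f2 = m2" "pathfinish f2 = u"
    "path_image f1 \<union> path_image f2 = path_image \<gamma>" "path_image f1 \<inter> path_image f2 = {u}"
    using arc_split [OF \<gamma>(1) u\<gamma>] \<gamma> une by metis
  show thesis
  proof
    show "arc (reversepath f1)" "arc (reversepath f2)" "arc h3"
      using f h3 by (auto simp: arc_reversepath)
    show "path_image (reversepath f1) \<union> path_image (reversepath f2) \<union> path_image h3
      \<subseteq> X \<union> path_image e1 \<union> path_image e2 \<union> path_image e3"
      using f(7) \<gamma>(2) h3(2) h(3) d(2) by (simp only: path_image_reversepath) blast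
    show "path_image (reversepath f1) \<inter> path_image (reversepath f2) \<subseteq> {u}"
      "path_image (reversepath f1) \<inter> path_image h3 \<subseteq> {u}"
      "path_image (reversepath f2) \<inter> path_image h3 \<subseteq> {u}"
      using f(7,8) h\<gamma> h3(2) by (simp_all only: path_image_reversepath) blast+
  qed (use f h3 m_def in auto)
qed

text \<open>The open set \<open>inside C\<close> is disjoint from \<open>outside D\<close>, hence
  from its closure. Thus a closed curve within a drawing never encloses a vertex on the boundary of
  the outer face.\<close>

lemma closure_outside_disjoint_inside:
  fixes C D :: "'a::real_normed_vector set"
  assumes "C \<subseteq> D" "closed C" "m \<in> closure (outside D)"
  shows "m \<notin> inside C"
proof -
  have "inside C \<inter> outside D = {}"
    using outside_mono [OF assms(1)] inside_Int_outside [of C] by blast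
  then have "inside C \<inter> closure (outside D) = {}"
    using open_inside [OF assms(2)] by (simp add: open_Int_closure_eq_empty)
  then show ?thesis
    using assms by blast
qed

text \<open>Each arc is cut at its mark. \<open>X\<close> with three halves shrinks to a tripod
  centred at \<open>u\<close>, \<open>Y\<close> with the other halves to one centred at
  \<open>v\<close>; glued at the marks they form a theta curve. Two of its legs then enclose the
  third with its mark, although the mark is in the closure of the outer face.\<close>

lemma three_marked_arcs_between_continua:
  fixes X Y :: "complex set"
  assumes X: "closed X" "path_connected X" and Y: "closed Y" "path_connected Y" and XY: "X \<inter> Y = {}"
    and J: "i1 \<in> J" "i2 \<in> J" "i3 \<in> J" and ne: "i1 \<noteq> i2" "i1 \<noteq> i3" "i2 \<noteq> i3"
    and g: "\<And>i. i \<in> J \<Longrightarrow> arc (g i)"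
      "\<And>i. i \<in> J \<Longrightarrow> pathstart (g i) \<in> X" "\<And>i. i \<in> J \<Longrightarrow> pathfinish (g i) \<in> Y"
      "\<And>i. i \<in> J \<Longrightarrow> path_image (g i) \<inter> (X \<union> Y) \<subseteq> {pathstart (g i), pathfinish (g i)}"
      "\<And>i j. i \<in> J \<Longrightarrow> j \<in> J \<Longrightarrow> i \<noteq> j \<Longrightarrow> path_image (g i) \<inter> path_image (g j) \<subseteq> X \<union> Y"
    and m: "\<And>i. i \<in> J \<Longrightarrow> m i \<in> path_image (g i)" "\<And>i. i \<in> J \<Longrightarrow> m i \<notin> X \<union> Y"
      "\<And>i. i \<in> J \<Longrightarrow> m i \<in> closure (outside D)"
    and D: "X \<subseteq> D" "Y \<subseteq> D" "\<And>i. i \<in> J \<Longrightarrow> path_image (g i) \<subseteq> D"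
  shows False
proof -
  have "\<exists>e f. arc e \<and> pathstart e = pathstart (g i) \<and> pathfinish e = m i \<and>
    arc f \<and> pathstart f = pathfinish (g i) \<and> pathfinish f = m i \<and>
    path_image e \<union> path_image f = path_image (g i) \<and> path_image e \<inter> path_image f = {m i}"
    if "i \<in> J" for i
    using arc_split [OF g(1) m(1), OF that that] g(2,3) [OF that] m(2) [OF that]
    by (metis UnCI)
  then obtain e f where ef': "\<And>i. i \<in> J \<Longrightarrow> arc (e i) \<and> pathstart (e i) = pathstart (g i) \<and> pathfinish (e i) = m i \<and>
    arc (f i) \<and> pathstart (f i) = pathfinish (g i) \<and> pathfinish (f i) = m i \<and>
    path_image (e i) \<union> path_image (f i) = path_image (g i) \<and> path_image (e i) \<inter> path_image (f i) = {m i}"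
    by metis
  then have ef: "\<And>i. i \<in> J \<Longrightarrow> arc (e i)" "\<And>i. i \<in> J \<Longrightarrow> arc (f i)"
    "\<And>i. i \<in> J \<Longrightarrow> pathstart (e i) = pathstart (g i)" "\<And>i. i \<in> J \<Longrightarrow> pathfinish (e i) = m i"
    "\<And>i. i \<in> J \<Longrightarrow> pathstart (f i) = pathfinish (g i)" "\<And>i. i \<in> J \<Longrightarrow> pathfinish (f i) = m i"
    "\<And>i. i \<in> J \<Longrightarrow> path_image (e i) \<union> path_image (f i) = path_image (g i)"
    "\<And>i. i \<in> J \<Longrightarrow> path_image (e i) \<inter> path_image (f i) = {m i}"
    by blast+
  \<comment> \<open>\<open>g i\<close> touches \<open>X \<union> Y\<close> only at its two ends, and
    each half contains only one of them.\<close>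
  have eY: "path_image (e i) \<inter> Y = {}" and fX: "path_image (f i) \<inter> X = {}" if "i \<in> J" for i
  proof -
    have "pathstart (g i) \<in> path_image (e i)" "pathfinish (g i) \<in> path_image (f i)"
      using ef(3,5) [OF that] pathstart_in_path_image by metis+
    then have "pathstart (g i) \<notin> path_image (f i)" "pathfinish (g i) \<notin> path_image (e i)"
      using ef(8) [OF that] g(2,3) [OF that] m(2) [OF that] by (metis IntI UnCI singletonD)+
    then show "path_image (e i) \<inter> Y = {}" "path_image (f i) \<inter> X = {}"
      using g(2-4) [OF that] ef(7) [OF that] XY by blast+
  qed
  have eg: "path_image (e i) \<subseteq> path_image (g i)" and fg: "path_image (f i) \<subseteq> path_image (g i)"
    if "i \<in> J" for i
    using ef(7) [OF that] by blast+
  have eX: "path_image (e i) \<inter> path_image (e j) \<subseteq> X" and fY: "path_image (f i) \<inter> path_image (f j) \<subseteq> Y"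
    and ef0: "path_image (e i) \<inter> path_image (f j) = {}"
    if "i \<in> J" "j \<in> J" "i \<noteq> j" for i j
    using g(5) [OF that] eg fg eY fX that by blast+
  have mXY: "m i \<notin> X" "m i \<notin> Y" if "i \<in> J" for i
    using m(2) [OF that] by blast+
  obtain u h1 h2 h3 where h: "arc h1" "arc h2" "arc h3"
    "pathstart h1 = u" "pathstart h2 = u" "pathstart h3 = u"
    "pathfinish h1 = m i1" "pathfinish h2 = m i2" "pathfinish h3 = m i3"
    "path_image h1 \<union> path_image h2 \<union> path_image h3 \<subseteq> X \<union> path_image (e i1) \<union> path_image (e i2) \<union> path_image (e i3)"
    "path_image h1 \<inter> path_image h2 \<subseteq> {u}" "path_image h1 \<inter> path_image h3 \<subseteq> {u}"
    "path_image h2 \<inter> path_image h3 \<subseteq> {u}"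
    using tripod [OF X, of "e i1" "e i2" "e i3"] J ne ef(1,3,4) g(2) mXY eX
    by (simp add: arc_imp_path) metis
  obtain v k1 k2 k3 where k: "arc k1" "arc k2" "arc k3"
    "pathstart k1 = v" "pathstart k2 = v" "pathstart k3 = v"
    "pathfinish k1 = m i1" "pathfinish k2 = m i2" "pathfinish k3 = m i3"
    "path_image k1 \<union> path_image k2 \<union> path_image k3 \<subseteq> Y \<union> path_image (f i1) \<union> path_image (f i2) \<union> path_image (f i3)"
    "path_image k1 \<inter> path_image k2 \<subseteq> {v}" "path_image k1 \<inter> path_image k3 \<subseteq> {v}"
    "path_image k2 \<inter> path_image k3 \<subseteq> {v}"
    using tripod [OF Y, of "f i1" "f i2" "f i3"] J ne ef(2,5,6) g(3) mXY fY
    by (simp add: arc_imp_path) metis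
  let ?A = "X \<union> path_image (e i1) \<union> path_image (e i2) \<union> path_image (e i3)"
  let ?B = "Y \<union> path_image (f i1) \<union> path_image (f i2) \<union> path_image (f i3)"
  \<comment> \<open>The tripods lie in \<open>?A\<close> and \<open>?B\<close>, which share only the
    marks, and no leg contains the mark of another; so legs of different index from the two tripods
    are disjoint.\<close>
  have AB: "?A \<inter> ?B \<subseteq> {m i1, m i2, m i3}"
    unfolding Int_Un_distrib Int_Un_distrib2
    using XY eY fX ef0 ef(8) J ne by (simp add: Int_commute)
  have mh: "m i1 \<in> path_image h1" "m i2 \<in> path_image h2" "m i3 \<in> path_image h3"
    and mk: "m i1 \<in> path_image k1" "m i2 \<in> path_image k2" "m i3 \<in> path_image k3"
    using h(7-9) k(7-9) pathfinish_in_path_image by metis+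
  have um: "u \<noteq> m i1" "u \<noteq> m i2" "u \<noteq> m i3" and vm: "v \<noteq> m i1" "v \<noteq> m i2" "v \<noteq> m i3"
    using h(1-9) k(1-9) arc_distinct_ends by metis+
  have hk: "path_image h1 \<inter> path_image k1 \<subseteq> {m i1}" "path_image h2 \<inter> path_image k2 \<subseteq> {m i2}"
    "path_image h3 \<inter> path_image k3 \<subseteq> {m i3}"
    "path_image h1 \<inter> path_image k2 = {}" "path_image h1 \<inter> path_image k3 = {}"
    "path_image h2 \<inter> path_image k1 = {}" "path_image h2 \<inter> path_image k3 = {}"
    "path_image h3 \<inter> path_image k1 = {}" "path_image h3 \<inter> path_image k2 = {}"
  proof -
    have 0: "path_image a \<inter> path_image b \<subseteq> {m i1, m i2, m i3}"
      if "path_image a \<subseteq> ?A" "path_image b \<subseteq> ?B" for a b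
      using that AB by (meson Int_mono order_trans)
    have 1: "path_image h1 \<subseteq> ?A" "path_image h2 \<subseteq> ?A" "path_image h3 \<subseteq> ?A"
      "path_image k1 \<subseteq> ?B" "path_image k2 \<subseteq> ?B" "path_image k3 \<subseteq> ?B"
      using h(10) k(10) by simp_all
    have 2: "m i2 \<notin> path_image h1" "m i3 \<notin> path_image h1" "m i1 \<notin> path_image h2"
      "m i3 \<notin> path_image h2" "m i1 \<notin> path_image h3" "m i2 \<notin> path_image h3"
      using h(11-13) um mh by blast+
    have 3: "m i2 \<notin> path_image k1" "m i3 \<notin> path_image k1" "m i1 \<notin> path_image k2"
      "m i3 \<notin> path_image k2" "m i1 \<notin> path_image k3" "m i2 \<notin> path_image k3"
      using k(11-13) vm mk by blast+
    show "path_image h1 \<inter> path_image k1 \<subseteq> {m i1}"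
      using 0 [OF 1(1) 1(4)] 2(1,2) by blast
    show "path_image h2 \<inter> path_image k2 \<subseteq> {m i2}"
      using 0 [OF 1(2) 1(5)] 2(3,4) by blast
    show "path_image h3 \<inter> path_image k3 \<subseteq> {m i3}"
      using 0 [OF 1(3) 1(6)] 2(5,6) by blast
    show "path_image h1 \<inter> path_image k2 = {}"
      using 0 [OF 1(1) 1(5)] 2(1,2) 3(3) by blast
    show "path_image h1 \<inter> path_image k3 = {}"
      using 0 [OF 1(1) 1(6)] 2(1,2) 3(5) by blast
    show "path_image h2 \<inter> path_image k1 = {}"
      using 0 [OF 1(2) 1(4)] 2(3,4) 3(1) by blast
    show "path_image h2 \<inter> path_image k3 = {}"
      using 0 [OF 1(2) 1(6)] 2(3,4) 3(6) by blast
    show "path_image h3 \<inter> path_image k1 = {}"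
      using 0 [OF 1(3) 1(4)] 2(5,6) 3(2) by blast
    show "path_image h3 \<inter> path_image k2 = {}"
      using 0 [OF 1(3) 1(5)] 2(5,6) 3(4) by blast
  qed
  let ?c1 = "h1 +++ reversepath k1" and ?c2 = "h2 +++ reversepath k2" and ?c3 = "h3 +++ reversepath k3"
  have pi: "path_image ?c1 = path_image h1 \<union> path_image k1"
    "path_image ?c2 = path_image h2 \<union> path_image k2"
    "path_image ?c3 = path_image h3 \<union> path_image k3"
    using h(7-9) k(7-9) by (simp_all add: path_image_join)
  have arcs: "arc ?c1" "arc ?c2" "arc ?c3"
    using h(1-9) k(1-9) hk(1-3) by (auto intro!: arc_join simp: arc_reversepath)
  have ends: "pathstart ?c1 = u" "pathfinish ?c1 = v" "pathstart ?c2 = u" "pathfinish ?c2 = v"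
    "pathstart ?c3 = u" "pathfinish ?c3 = v"
    using h(4-6) k(4-6) by simp_all
  have "?A \<union> ?B \<subseteq> D"
  proof -
    have "path_image (e i) \<subseteq> D" "path_image (f i) \<subseteq> D" if "i \<in> J" for i
      using eg [OF that] fg [OF that] D(3) [OF that] by blast+
    then show ?thesis
      using D(1,2) J by simp
  qed
  then have ABD: "?A \<subseteq> D" "?B \<subseteq> D"
    by simp_all
  have "path_image h1 \<union> path_image h2 \<union> path_image h3 \<subseteq> D"
    "path_image k1 \<union> path_image k2 \<union> path_image k3 \<subseteq> D"
    by (rule subset_trans [OF h(10) ABD(1)]) (rule subset_trans [OF k(10) ABD(2)])
  then have "path_image h1 \<subseteq> D" "path_image h2 \<subseteq> D" "path_image h3 \<subseteq> D"
    "path_image k1 \<subseteq> D" "path_image k2 \<subseteq> D" "path_image k3 \<subseteq> D"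
    by simp_all
  then have cD: "path_image ?c1 \<subseteq> D" "path_image ?c2 \<subseteq> D" "path_image ?c3 \<subseteq> D"
    unfolding pi by simp_all
  have nin: "m i \<notin> inside (path_image a \<union> path_image b)"
    if "path_image a \<subseteq> D" "path_image b \<subseteq> D" "arc a" "arc b" "i \<in> J" for a b i
    using that m(3) by (intro closure_outside_disjoint_inside [where D = D]) (auto simp: closed_arc_image)
  have "path_image ?c3 - {u, v} \<subseteq> inside (path_image ?c1 \<union> path_image ?c2)"
  proof (rule theta_marked_arcs [OF arcs ends])
    show "path_image ?c1 \<inter> path_image ?c2 \<subseteq> {u, v}"
      unfolding pi using h(11) k(11) hk(4,6) by blast
    show "path_image ?c1 \<inter> path_image ?c3 \<subseteq> {u, v}"
      unfolding pi using h(12) k(12) hk(5,8) by blast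
    show "path_image ?c2 \<inter> path_image ?c3 \<subseteq> {u, v}"
      unfolding pi using h(13) k(13) hk(7,9) by blast
    show "m i1 \<in> path_image ?c1 - {u, v}" "m i2 \<in> path_image ?c2 - {u, v}"
      unfolding pi using mh(1,2) um(1,2) vm(1,2) by simp_all
    show "m i1 \<notin> inside (path_image ?c2 \<union> path_image ?c3)"
      "m i2 \<notin> inside (path_image ?c1 \<union> path_image ?c3)"
      using nin [OF cD(2,3) arcs(2,3) J(1)] nin [OF cD(1,3) arcs(1,3) J(2)] by simp_all
  qed
  moreover have "m i3 \<in> path_image ?c3 - {u, v}"
    unfolding pi using mh(3) um(3) vm(3) by simp
  ultimately show False
    using nin [OF cD(1,2) arcs(1,2) J(3)] by blast
qed

text \<open>
  Induction on the number of continua: an arc \<open>g i0\<close> from \<open>X\<close> to \<open>Y\<close> is contracted, that is,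
  \<open>X \<union> g i0 \<union> Y\<close> becomes a single continuum; at most two arcs join \<open>X\<close> and \<open>Y\<close> and are lost.
\<close>

lemma card_marked_arcs_between_continua:
  fixes P :: "complex set set" and g :: "'i \<Rightarrow> real \<Rightarrow> complex"
  assumes "finite P" "finite I"
    and "\<And>X. X \<in> P \<Longrightarrow> compact X \<and> path_connected X" "disjoint P"
    and "\<And>i. i \<in> I \<Longrightarrow> arc (g i)"
    and "\<And>i. i \<in> I \<Longrightarrow> \<exists>X\<in>P. \<exists>Y\<in>P. X \<noteq> Y \<and> pathstart (g i) \<in> X \<and> pathfinish (g i) \<in> Y"
    and "\<And>i. i \<in> I \<Longrightarrow> path_image (g i) \<inter> \<Union>P \<subseteq> {pathstart (g i), pathfinish (g i)}"
    and "\<And>i j. i \<in> I \<Longrightarrow> j \<in> I \<Longrightarrow> i \<noteq> j \<Longrightarrow> path_image (g i) \<inter> path_image (g j) \<subseteq> \<Union>P"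
    and "\<And>i. i \<in> I \<Longrightarrow> m i \<in> path_image (g i) - \<Union>P"
    and "\<And>i. i \<in> I \<Longrightarrow> m i \<in> closure (outside D)"
    and "\<Union>P \<subseteq> D" "\<And>i. i \<in> I \<Longrightarrow> path_image (g i) \<subseteq> D"
  shows "card I \<le> 2 * (card P - 1)"
  using assms
proof (induction "card P" arbitrary: P I rule: less_induct)
  case less
  note fin = less.prems(1,2) and P = less.prems(3) and disj = less.prems(4)
    and arc = less.prems(5) and ends = less.prems(6) and meet = less.prems(7)
    and cross = less.prems(8) and mark = less.prems(9) and mD = less.prems(10)
    and PD = less.prems(11) and gD = less.prems(12)
  show ?case
  proof (cases "I = {}")
    case False
    then obtain i0 where i0: "i0 \<in> I"
      by blast
    with ends obtain X Y where XY: "X \<in> P" "Y \<in> P" "X \<noteq> Y"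
      "pathstart (g i0) \<in> X" "pathfinish (g i0) \<in> Y"
      by blast
    then have XY0: "X \<inter> Y = {}"
      using disj by (auto simp: disjoint_def)
    define Z where "Z = X \<union> path_image (g i0) \<union> Y"
    define P' where "P' = insert Z (P - {X, Y})"
    \<comment> \<open>\<open>J\<close> collects the arcs that become loops when \<open>Z\<close> is
      contracted to one continuum, among them \<open>g i0\<close>.\<close>
    define J where "J = {i \<in> I. pathstart (g i) \<in> X \<union> Y \<and> pathfinish (g i) \<in> X \<union> Y}"
    have UP': "\<Union>P' = \<Union>P \<union> path_image (g i0)"
      using XY unfolding P'_def Z_def by blast
    have other: "W \<inter> Z = {}" if "W \<in> P - {X, Y}" for W
    proof -
      have "W \<inter> X = {}" "W \<inter> Y = {}"
        using that XY disj by (auto simp: disjoint_def)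
      moreover have "W \<inter> path_image (g i0) \<subseteq> {pathstart (g i0), pathfinish (g i0)}"
        using meet [OF i0] that by blast
      ultimately show ?thesis
        using XY(4,5) unfolding Z_def by blast
    qed
    have Z: "compact Z" "path_connected Z"
      using P XY arc [OF i0] unfolding Z_def
      by (auto intro!: compact_Un path_connected_Un path_connected_path_image
          simp: compact_arc_image arc_imp_path)
    have Zne: "Z \<notin> P - {X, Y}"
      using other [of Z] XY(4) unfolding Z_def by blast
    have "card {X, Y} \<le> card P"
      using fin XY by (intro card_mono) auto
    then have "2 \<le> card P"
      using XY by simp
    moreover have "card (P - {X, Y}) = card P - 2"
      using fin XY by (subst card_Diff_subset) auto
    ultimately have cP': "card P' = card P - 1" "card P' < card P" "2 \<le> card P"
      using fin Zne unfolding P'_def by auto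
    have "card (I - J) \<le> 2 * (card P' - 1)"
    proof (rule less.hyps [OF cP'(2)])
      show "finite P'" "finite (I - J)"
        using fin by (auto simp: P'_def)
      show "compact W \<and> path_connected W" if "W \<in> P'" for W
        using that P Z unfolding P'_def by blast
      show "disjoint P'"
        using disj other unfolding P'_def disjoint_def by blast
      show "\<exists>V\<in>P'. \<exists>W\<in>P'. V \<noteq> W \<and> pathstart (g i) \<in> V \<and> pathfinish (g i) \<in> W"
        if i: "i \<in> I - J" for i
      proof -
        obtain V W where VW: "V \<in> P" "W \<in> P" "V \<noteq> W" "pathstart (g i) \<in> V" "pathfinish (g i) \<in> W"
          using ends i by blast
        have "\<not> (V \<in> {X, Y} \<and> W \<in> {X, Y})"
          using i VW unfolding J_def by blast
        then consider "V \<in> P - {X, Y}" "W \<in> P - {X, Y}" | "V \<in> {X, Y}" "W \<in> P - {X, Y}"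
          | "V \<in> P - {X, Y}" "W \<in> {X, Y}"
          using VW by blast
        then show ?thesis
        proof cases
          case 1
          then show ?thesis
            using VW unfolding P'_def by blast
        next
          case 2
          then have "pathstart (g i) \<in> Z" "W \<noteq> Z"
            using VW Zne unfolding Z_def by blast+
          then show ?thesis
            using 2 VW unfolding P'_def by blast
        next
          case 3
          then have "pathfinish (g i) \<in> Z" "V \<noteq> Z"
            using VW Zne unfolding Z_def by blast+
          then show ?thesis
            using 3 VW unfolding P'_def by blast
        qed
      qed
      have i0J: "i0 \<in> J"
        using i0 XY unfolding J_def by blast
      \<comment> \<open>Different arcs cross only inside \<open>\<Union>P\<close>, so adding
        \<open>g i0\<close> to the union creates no new contacts and swallows no mark.\<close>
      then have c: "path_image (g i) \<inter> path_image (g i0) \<subseteq> \<Union>P" if "i \<in> I - J" for i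
        using that i0 by (intro cross) auto
      show "path_image (g i) \<inter> \<Union>P' \<subseteq> {pathstart (g i), pathfinish (g i)}" if "i \<in> I - J" for i
        using c [OF that] meet [of i] that unfolding UP' by blast
      show "path_image (g i) \<inter> path_image (g j) \<subseteq> \<Union>P'"
        if "i \<in> I - J" "j \<in> I - J" "i \<noteq> j" for i j
        using cross [of i j] that unfolding UP' by blast
      show "m i \<in> path_image (g i) - \<Union>P'" if "i \<in> I - J" for i
        using mark [of i] c [OF that] that unfolding UP' by blast
      show "m i \<in> closure (outside D)" if "i \<in> I - J" for i
        using mD that by blast
      show "\<Union>P' \<subseteq> D"
        using PD gD i0 unfolding UP' by blast
      show "path_image (g i) \<subseteq> D" "arc (g i)" if "i \<in> I - J" for i
        using gD arc that by blast+
    qed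
    moreover have "card J \<le> 2"
    proof (rule ccontr)
      assume "\<not> card J \<le> 2"
      then obtain T where "T \<subseteq> J" "card T = 3"
        by (metis obtain_subset_with_card_n not_less_eq_eq numeral_2_eq_2 numeral_3_eq_3)
      then obtain i1 i2 i3 where i: "i1 \<in> J" "i2 \<in> J" "i3 \<in> J" "i1 \<noteq> i2" "i1 \<noteq> i3" "i2 \<noteq> i3"
        by (auto simp: card_3_iff)
      \<comment> \<open>Arcs running from \<open>Y\<close> to \<open>X\<close> are reversed so that
        all of them start in \<open>X\<close>.\<close>
      define g' where "g' i = (if pathstart (g i) \<in> X then g i else reversepath (g i))" for i
      have pi: "path_image (g' i) = path_image (g i)" for i
        by (simp add: g'_def)
      have JI: "j \<in> I" if "j \<in> J" for j
        using that by (simp add: J_def)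
      have xy: "pathstart (g j) \<in> X \<and> pathfinish (g j) \<in> Y \<or> pathstart (g j) \<in> Y \<and> pathfinish (g j) \<in> X"
        if j: "j \<in> J" for j
      proof -
        obtain V W where VW: "V \<in> P" "W \<in> P" "V \<noteq> W" "pathstart (g j) \<in> V" "pathfinish (g j) \<in> W"
          using ends JI [OF j] by blast
        moreover have "A = B" if "A \<in> P" "B \<in> P" "x \<in> A" "x \<in> B" for A B x
          using disj that by (auto simp: disjoint_def)
        ultimately show ?thesis
          using j XY(1,2) unfolding J_def by (metis (mono_tags, lifting) Un_iff mem_Collect_eq)
      qed
      have meet': "path_image (g j) \<inter> (X \<union> Y) \<subseteq> {pathstart (g j), pathfinish (g j)}" if "j \<in> J" for j
        using meet [OF JI [OF that]] XY(1,2) by blast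
      have cross': "path_image (g i) \<inter> path_image (g j) \<subseteq> X \<union> Y" if "i \<in> J" "j \<in> J" "i \<noteq> j" for i j
        using cross [OF JI JI, OF that] meet [OF JI, OF that(1)] xy [OF that(1)] by blast
      show False
      proof (rule three_marked_arcs_between_continua [OF _ _ _ _ XY0 i, where g = g' and m = m and D = D])
        show "closed X" "closed Y" "path_connected X" "path_connected Y"
          using P XY(1,2) by (auto simp: compact_imp_closed)
        show "arc (g' j)" if "j \<in> J" for j
          using arc [OF JI [OF that]] by (simp add: g'_def arc_reversepath)
        show "pathstart (g' j) \<in> X" "pathfinish (g' j) \<in> Y" if "j \<in> J" for j
          using xy [OF that] XY0 by (auto simp: g'_def)
        show "path_image (g' j) \<inter> (X \<union> Y) \<subseteq> {pathstart (g' j), pathfinish (g' j)}" if "j \<in> J" for j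
          using meet' [OF that] by (auto simp: g'_def)
        show "path_image (g' i) \<inter> path_image (g' j) \<subseteq> X \<union> Y" if "i \<in> J" "j \<in> J" "i \<noteq> j" for i j
          using cross' [OF that] by (simp add: pi)
        show "m j \<in> path_image (g' j)" if "j \<in> J" for j
          using mark [OF JI [OF that]] by (simp add: pi)
        show "m j \<notin> X \<union> Y" if "j \<in> J" for j
          using mark [OF JI [OF that]] XY(1,2) by blast
        show "m j \<in> closure (outside D)" "path_image (g' j) \<subseteq> D" if "j \<in> J" for j
          using mD [OF JI [OF that]] gD [OF JI [OF that]] by (simp_all add: pi)
        show "X \<subseteq> D" "Y \<subseteq> D"
          using PD XY(1,2) by blast+
      qed
    qed
    moreover have "card I \<le> card (I - J) + card J"
    proof -
      have "I = (I - J) \<union> J"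
        by (auto simp: J_def)
      then show ?thesis
        using card_Un_le [of "I - J" J] by simp
    qed
    \<comment> \<open>In total at most \<open>2 * (card P - 2) + 2\<close> arcs;
      \<open>2 \<le> card P\<close> keeps the truncated subtractions exact.\<close>
    ultimately show ?thesis
      using cP' by linarith
  qed simp
qed

section \<open>Outerplanar graphs\<close>

lemma pair_graph_facts:
  assumes "pair_graph G"
  shows "finite (pverts G)" "(u, v) \<in> parcs G \<Longrightarrow> (v, u) \<in> parcs G"
    "(u, v) \<in> parcs G \<Longrightarrow> u \<in> pverts G" "(u, v) \<in> parcs G \<Longrightarrow> v \<in> pverts G"
    "(u, v) \<in> parcs G \<Longrightarrow> u \<noteq> v"
proof -
  interpret pair_graph G by fact
  show "finite (pverts G)"
    by (rule pair_finite_verts)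
  show "(u, v) \<in> parcs G \<Longrightarrow> u \<in> pverts G"
    by (rule in_arcsD1)
  show "(u, v) \<in> parcs G \<Longrightarrow> v \<in> pverts G"
    by (rule in_arcsD2)
  show "(u, v) \<in> parcs G \<Longrightarrow> (v, u) \<in> parcs G"
    using pair_sym_arcs unfolding symmetric_def with_proj_simps by (rule symD)
  show "(u, v) \<in> parcs G \<Longrightarrow> u \<noteq> v"
    using pair_no_loops [of "(u, v)"] by simp
qed

lemma outerplanarE:
  assumes "outerplanar G"
  obtains p c where "plane_embedding G p c"
    "\<And>v. v \<in> pverts G \<Longrightarrow> p v \<in> closure (outside (drawing G p c))"
proof -
  obtain p c where pc: "plane_embedding G p c" "p ` pverts G \<subseteq> frontier (outside (drawing G p c))"
    using assms unfolding outerplanar_def by (elim exE conjE)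
  show thesis
  proof (rule that [OF pc(1)])
    show "p v \<in> closure (outside (drawing G p c))" if "v \<in> pverts G" for v
      using pc(2) that by (auto simp: frontier_def)
  qed
qed

lemma uedges_pair: "(u, v) \<in> parcs G \<Longrightarrow> {u, v} \<in> uedges G"
  unfolding uedges_def by blast

lemma plane_embedding_edge:
  assumes "plane_embedding G p c" "(u, v) \<in> parcs G"
  obtains \<gamma> where "arc \<gamma>" "pathstart \<gamma> = p u" "pathfinish \<gamma> = p v"
    "path_image \<gamma> = path_image (c {u, v})"
proof -
  have "{u, v} \<in> uedges G"
    by (rule uedges_pair [OF assms(2)])
  with assms(1) have e: "arc (c {u, v})" "{pathstart (c {u, v}), pathfinish (c {u, v})} = {p u, p v}"
    by (auto simp: plane_embedding_def)
  then consider "pathstart (c {u, v}) = p u" "pathfinish (c {u, v}) = p v"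
    | "pathstart (c {u, v}) = p v" "pathfinish (c {u, v}) = p u"
    by (auto simp: doubleton_eq_iff)
  then show thesis
  proof cases
    case 1
    then show thesis
      using that e by blast
  next
    case 2
    then show thesis
      using that [of "reversepath (c {u, v})"] e by (simp add: arc_reversepath)
  qed
qed

lemma plane_embedding_edge_vertices:
  assumes "plane_embedding G p c" "(u, v) \<in> parcs G"
  shows "path_image (c {u, v}) \<inter> p ` pverts G = {p u, p v}"
proof -
  have "path_image (c {u, v}) \<inter> p ` pverts G = p ` {u, v}"
    using assms(1) uedges_pair [OF assms(2)] by (simp add: plane_embedding_def)
  then show ?thesis
    by simp
qed

lemma plane_embedding_edges_meet:
  assumes "plane_embedding G p c" "(u, v) \<in> parcs G" "(x, y) \<in> parcs G" "{u, v} \<noteq> {x, y}"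
  shows "path_image (c {u, v}) \<inter> path_image (c {x, y}) \<subseteq> p ` ({u, v} \<inter> {x, y})"
proof -
  have "\<forall>e\<in>uedges G. \<forall>f\<in>uedges G. e \<noteq> f \<longrightarrow> path_image (c e) \<inter> path_image (c f) \<subseteq> p ` (e \<inter> f)"
    using assms(1) by (simp add: plane_embedding_def)
  from this [rule_format, OF uedges_pair [OF assms(2)] uedges_pair [OF assms(3)] assms(4)]
  show ?thesis .
qed

lemma plane_embedding_edge_drawing:
  assumes "(u, v) \<in> parcs G"
  shows "path_image (c {u, v}) \<subseteq> drawing G p c"
  unfolding drawing_def by (rule le_supI2, rule UN_upper, rule uedges_pair [OF assms])

text \<open>Each \<open>b\<close> yields an arc through \<open>p b\<close> between two drawn
  vertices of \<open>S\<close>. With \<open>p b\<close> as its mark and the drawn vertices of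
  \<open>S\<close> as one-point continua, the count of marked arcs applies.\<close>

lemma outerplanar_card_two_neighbours:
  assumes G: "pair_graph G" "outerplanar G" and S: "S \<subseteq> pverts G" and B: "B \<subseteq> pverts G" "S \<inter> B = {}"
    and nb: "\<And>b. b \<in> B \<Longrightarrow> \<exists>s\<in>S. \<exists>t\<in>S. s \<noteq> t \<and> (b, s) \<in> parcs G \<and> (b, t) \<in> parcs G"
  shows "card B \<le> 2 * (card S - 1)"
proof -
  from G(2) obtain p c where pc: "plane_embedding G p c"
    and outer: "\<And>v. v \<in> pverts G \<Longrightarrow> p v \<in> closure (outside (drawing G p c))"
    by (rule outerplanarE) blast
  have inj: "inj_on p (pverts G)"
    using pc by (simp add: plane_embedding_def)
  have fin: "finite S" "finite B"
    using pair_graph_facts(1) [OF G(1)] S B finite_subset by blast+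
  obtain s t where st: "\<And>b. b \<in> B \<Longrightarrow> s b \<in> S" "\<And>b. b \<in> B \<Longrightarrow> t b \<in> S" "\<And>b. b \<in> B \<Longrightarrow> s b \<noteq> t b"
    "\<And>b. b \<in> B \<Longrightarrow> (b, s b) \<in> parcs G" "\<And>b. b \<in> B \<Longrightarrow> (b, t b) \<in> parcs G"
    using nb by metis
  let ?Q = "\<lambda>b. path_image (c {b, s b}) \<union> path_image (c {b, t b})"
  have "\<exists>\<gamma>. arc \<gamma> \<and> pathstart \<gamma> = p (s b) \<and> pathfinish \<gamma> = p (t b) \<and> path_image \<gamma> = ?Q b"
    if b: "b \<in> B" for b
  proof -
    obtain \<gamma>1 where 1: "arc \<gamma>1" "pathstart \<gamma>1 = p b" "pathfinish \<gamma>1 = p (s b)"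
      "path_image \<gamma>1 = path_image (c {b, s b})"
      using plane_embedding_edge [OF pc st(4) [OF b]] by blast
    obtain \<gamma>2 where 2: "arc \<gamma>2" "pathstart \<gamma>2 = p b" "pathfinish \<gamma>2 = p (t b)"
      "path_image \<gamma>2 = path_image (c {b, t b})"
      using plane_embedding_edge [OF pc st(5) [OF b]] by blast
    have "{b, s b} \<noteq> {b, t b}" "{b, s b} \<inter> {b, t b} = {b}"
      using st(1-3) [OF b] B(2) b by (auto simp: doubleton_eq_iff)
    then have "path_image (c {b, s b}) \<inter> path_image (c {b, t b}) \<subseteq> {p b}"
      using plane_embedding_edges_meet [OF pc st(4) [OF b] st(5) [OF b]] by auto
    then show ?thesis
      using 1 2 by (intro exI [of _ "reversepath \<gamma>1 +++ \<gamma>2"])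
        (auto intro!: arc_join simp: arc_reversepath path_image_join)
  qed
  then obtain g where "\<And>b. b \<in> B \<Longrightarrow> arc (g b) \<and> pathstart (g b) = p (s b) \<and> pathfinish (g b) = p (t b)
    \<and> path_image (g b) = ?Q b"
    by metis
  then have g: "\<And>b. b \<in> B \<Longrightarrow> arc (g b)" "\<And>b. b \<in> B \<Longrightarrow> pathstart (g b) = p (s b)"
    "\<And>b. b \<in> B \<Longrightarrow> pathfinish (g b) = p (t b)" "\<And>b. b \<in> B \<Longrightarrow> path_image (g b) = ?Q b"
    by blast+
  define P where "P = (\<lambda>x. {p x}) ` S"
  have UP: "\<Union>P = p ` S"
    by (auto simp: P_def)
  have pS: "p x \<notin> p ` S" if "x \<in> B" for x
    using inj S B that unfolding inj_on_def by blast
  have "card B \<le> 2 * (card P - 1)"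
  proof (rule card_marked_arcs_between_continua [where g = g and m = p and D = "drawing G p c"])
    show "finite P" "finite B"
      using fin by (auto simp: P_def)
    show "compact X \<and> path_connected X" if "X \<in> P" for X
      using that by (auto simp: P_def)
    show "disjoint P"
      by (auto simp: P_def disjoint_def)
    show "arc (g b)" if "b \<in> B" for b
      using g that by blast
    show "\<exists>X\<in>P. \<exists>Y\<in>P. X \<noteq> Y \<and> pathstart (g b) \<in> X \<and> pathfinish (g b) \<in> Y" if b: "b \<in> B" for b
    proof -
      have "p (s b) \<noteq> p (t b)"
        using inj st(1-3) [OF b] S unfolding inj_on_def by blast
      then show ?thesis
        using st(1,2) [OF b] g(2,3) [OF b] by (auto simp: P_def)
    qed
    show "path_image (g b) \<inter> \<Union>P \<subseteq> {pathstart (g b), pathfinish (g b)}" if b: "b \<in> B" for b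
    proof -
      have *: "Q \<inter> W \<subseteq> {y}" if "Q \<inter> U = {x, y}" "W \<subseteq> U" "x \<notin> W" for Q U W :: "complex set" and x y
        using that by auto
      have **: "(Q \<union> Q') \<inter> W \<subseteq> {x, y}" if "Q \<inter> W \<subseteq> {x}" "Q' \<inter> W \<subseteq> {y}"
        for Q Q' W :: "complex set" and x y
        using that by auto
      have "path_image (c {b, x}) \<inter> p ` S \<subseteq> {p x}" if "(b, x) \<in> parcs G" for x
        by (rule * [OF plane_embedding_edge_vertices [OF pc that] image_mono [OF S] pS [OF b]])
      from this [OF st(4) [OF b]] this [OF st(5) [OF b]] show ?thesis
        unfolding UP g(2-4) [OF b] by (rule **)
    qed
    show "path_image (g a) \<inter> path_image (g b) \<subseteq> \<Union>P" if ab: "a \<in> B" "b \<in> B" "a \<noteq> b" for a b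
    proof -
      have *: "path_image (c {a, x}) \<inter> path_image (c {b, y}) \<subseteq> p ` S"
        if "(a, x) \<in> parcs G" "(b, y) \<in> parcs G" "x \<in> S" "y \<in> S" for x y
      proof -
        \<comment> \<open>A common end of the two edges is neither \<open>a\<close> nor
          \<open>b\<close>, so it belongs to \<open>S\<close>.\<close>
        have "a \<notin> {b, y}" "b \<notin> {a, x}"
          using that ab B(2) by auto
        then have "{a, x} \<noteq> {b, y}" "{a, x} \<inter> {b, y} \<subseteq> S"
          using that by auto
        then show ?thesis
          using plane_embedding_edges_meet [OF pc that(1,2)] by blast
      qed
      show ?thesis
        using * [OF st(4,4) st(1,1)] * [OF st(4,5) st(1,2)] * [OF st(5,4) st(2,1)] * [OF st(5,5) st(2,2)]
          ab unfolding UP g(4) [OF ab(1)] g(4) [OF ab(2)] by blast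
    qed
    show "p b \<in> path_image (g b) - \<Union>P" if b: "b \<in> B" for b
      using plane_embedding_edge_vertices [OF pc st(4) [OF b]] pS [OF b] unfolding UP g(4) [OF b] by blast
    show "p b \<in> closure (outside (drawing G p c))" if "b \<in> B" for b
      using outer that B by blast
    show "\<Union>P \<subseteq> drawing G p c"
      using S unfolding UP drawing_def by blast
    show "path_image (g b) \<subseteq> drawing G p c" if b: "b \<in> B" for b
      using plane_embedding_edge_drawing [OF st(4) [OF b]] plane_embedding_edge_drawing [OF st(5) [OF b]]
      unfolding g(4) [OF b] by blast
  qed
  moreover have "card P = card S"
    unfolding P_def using inj S by (intro card_image) (auto simp: inj_on_def)
  ultimately show ?thesis
    by simp
qed

text \<open>
  Both diagonals of the 4-cycle \<open>xyzw\<close> run inside it, so the diagonal \<open>yw\<close> enters one of the two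
  Jordan domains cut off by \<open>xz\<close>; being disjoint from \<open>xz\<close>, it drags \<open>w\<close> or \<open>y\<close> into that domain.
\<close>

lemma outerplanar_no_K4:
  assumes G: "pair_graph G" "outerplanar G"
    and "(x, y) \<in> parcs G" "(y, z) \<in> parcs G" "(z, w) \<in> parcs G" "(x, w) \<in> parcs G"
      "(x, z) \<in> parcs G" "(y, w) \<in> parcs G"
  shows False
proof -
  note sym = pair_graph_facts(2) [OF G(1)] and ne = pair_graph_facts(5) [OF G(1)]
  from G(2) obtain p c where pc: "plane_embedding G p c"
    and outer: "\<And>v. v \<in> pverts G \<Longrightarrow> p v \<in> closure (outside (drawing G p c))"
    by (rule outerplanarE) blast
  note V = pair_graph_facts(3,4) [OF G(1)]
  define Q where "Q u v = path_image (c {u, v})" for u v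
  have Qsym: "Q u v = Q v u" for u v
    by (simp add: Q_def insert_commute)
  have xV: "x \<in> pverts G" "y \<in> pverts G" "z \<in> pverts G" "w \<in> pverts G"
    using assms V by blast+
  have dist: "x \<noteq> y" "y \<noteq> z" "z \<noteq> w" "x \<noteq> w" "x \<noteq> z" "y \<noteq> w"
    using assms(3-) ne by blast+
  have "inj_on p (pverts G)"
    using pc by (simp add: plane_embedding_def)
  then have pdist: "p x \<noteq> p y" "p y \<noteq> p z" "p z \<noteq> p w" "p x \<noteq> p w" "p x \<noteq> p z" "p y \<noteq> p w"
    using xV dist by (auto dest: inj_onD)
  have E: "(x, y) \<in> parcs G" "(y, z) \<in> parcs G" "(z, w) \<in> parcs G" "(x, w) \<in> parcs G"
      "(x, z) \<in> parcs G" "(y, w) \<in> parcs G" "(w, z) \<in> parcs G" "(y, x) \<in> parcs G"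
    using assms sym by blast+
  have meet: "Q a b \<inter> Q a d \<subseteq> {p a}" if "(a, b) \<in> parcs G" "(a, d) \<in> parcs G" "b \<noteq> d" for a b d
    using plane_embedding_edges_meet [OF pc that(1,2)] ne that unfolding Q_def
    by (auto simp: doubleton_eq_iff)
  have apart: "Q a b \<inter> Q d e = {}"
    if "(a, b) \<in> parcs G" "(d, e) \<in> parcs G" "a \<noteq> d" "a \<noteq> e" "b \<noteq> d" "b \<noteq> e" for a b d e
    using plane_embedding_edges_meet [OF pc that(1,2)] that unfolding Q_def
    by (auto simp: doubleton_eq_iff)
  have ends: "p a \<in> Q a b" "p b \<in> Q a b" if "(a, b) \<in> parcs G" for a b
    using plane_embedding_edge_vertices [OF pc that(1)] unfolding Q_def by blast+
  have join: "\<exists>\<gamma>. arc \<gamma> \<and> pathstart \<gamma> = p a \<and> pathfinish \<gamma> = p d \<and> path_image \<gamma> = Q a b \<union> Q b d"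
    if e: "(a, b) \<in> parcs G" "(b, d) \<in> parcs G" "a \<noteq> d" for a b d
  proof -
    obtain \<gamma>1 where 1: "arc \<gamma>1" "pathstart \<gamma>1 = p a" "pathfinish \<gamma>1 = p b" "path_image \<gamma>1 = Q a b"
      using plane_embedding_edge [OF pc e(1)] unfolding Q_def by blast
    obtain \<gamma>2 where 2: "arc \<gamma>2" "pathstart \<gamma>2 = p b" "pathfinish \<gamma>2 = p d" "path_image \<gamma>2 = Q b d"
      using plane_embedding_edge [OF pc e(2)] unfolding Q_def by blast
    have "Q a b \<inter> Q b d \<subseteq> {p b}"
      using meet [of b a d] sym e Qsym by metis
    then show ?thesis
      using 1 2 by (intro exI [of _ "\<gamma>1 +++ \<gamma>2"]) (auto intro!: arc_join simp: path_image_join)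
  qed
  have nin: "p v \<notin> inside (A \<union> B)"
    if "v \<in> pverts G" "A \<subseteq> drawing G p c" "B \<subseteq> drawing G p c" "closed A" "closed B" for v A B
    using that outer by (intro closure_outside_disjoint_inside [where D = "drawing G p c"]) auto
  have QD: "Q a b \<subseteq> drawing G p c" if "(a, b) \<in> parcs G" for a b
    unfolding Q_def by (rule plane_embedding_edge_drawing [OF that])
  \<comment> \<open>The theta lemma for the diagonal \<open>ad\<close> of the 4-cycle
    \<open>abde\<close>, in a form that serves both diagonals of \<open>xyzw\<close>.\<close>
  have chord: "\<exists>c1 c2 c3. arc c1 \<and> arc c2 \<and> arc c3 \<and> pathstart c1 = p a \<and> pathfinish c1 = p d \<and>
      pathstart c2 = p a \<and> pathfinish c2 = p d \<and> pathstart c3 = p a \<and> pathfinish c3 = p d \<and>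
      path_image c1 = Q a b \<union> Q b d \<and> path_image c2 = Q a e \<union> Q e d \<and> path_image c3 = Q a d \<and>
      path_image c1 \<inter> path_image c2 = {p a, p d} \<and> path_image c1 \<inter> path_image c3 = {p a, p d} \<and>
      path_image c2 \<inter> path_image c3 = {p a, p d} \<and>
      path_image c3 - {p a, p d} \<subseteq> inside (path_image c1 \<union> path_image c2) \<and>
      p b \<notin> inside (path_image c2 \<union> path_image c3) \<and> p e \<notin> inside (path_image c1 \<union> path_image c3)"
    if e: "(a, b) \<in> parcs G" "(b, d) \<in> parcs G" "(a, e) \<in> parcs G" "(e, d) \<in> parcs G"
      "(a, d) \<in> parcs G" "b \<noteq> e" and pd: "p a \<noteq> p b" "p b \<noteq> p d" "p a \<noteq> p e" "p e \<noteq> p d"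
    for a b d e
  proof -
    have d: "a \<noteq> b" "b \<noteq> d" "a \<noteq> e" "e \<noteq> d" "a \<noteq> d"
      using e ne by blast+
    obtain c1 where c1: "arc c1" "pathstart c1 = p a" "pathfinish c1 = p d" "path_image c1 = Q a b \<union> Q b d"
      using join e d by blast
    obtain c2 where c2: "arc c2" "pathstart c2 = p a" "pathfinish c2 = p d" "path_image c2 = Q a e \<union> Q e d"
      using join e d by blast
    obtain c3 where c3: "arc c3" "pathstart c3 = p a" "pathfinish c3 = p d" "path_image c3 = Q a d"
      using plane_embedding_edge [OF pc e(5)] unfolding Q_def by blast
    have e': "(d, b) \<in> parcs G" "(d, e) \<in> parcs G" "(d, a) \<in> parcs G"
      using e sym by blast+
    have "Q a b \<inter> Q a e \<subseteq> {p a}" "Q a b \<inter> Q e d = {}" "Q b d \<inter> Q a e = {}" "Q b d \<inter> Q e d \<subseteq> {p d}"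
      "Q a b \<inter> Q a d \<subseteq> {p a}" "Q b d \<inter> Q a d \<subseteq> {p d}" "Q a e \<inter> Q a d \<subseteq> {p a}" "Q e d \<inter> Q a d \<subseteq> {p d}"
      using meet [OF e(1,3)] apart [OF e(1,4)] apart [OF e(2,3)] meet [OF e'(1,2)]
        meet [OF e(1,5)] meet [OF e'(1,3)] meet [OF e(3,5)] meet [OF e'(2,3)] d e(6)
      by (auto simp: Qsym [of d])
    then have int: "path_image c1 \<inter> path_image c2 = {p a, p d}" "path_image c1 \<inter> path_image c3 = {p a, p d}"
      "path_image c2 \<inter> path_image c3 = {p a, p d}"
      using ends [OF e(1)] ends [OF e(2)] ends [OF e(3)] ends [OF e(4)] ends [OF e(5)]
      unfolding c1(4) c2(4) c3(4) by blast+
    have D: "path_image c1 \<subseteq> drawing G p c" "path_image c2 \<subseteq> drawing G p c" "path_image c3 \<subseteq> drawing G p c"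
      using QD e unfolding c1(4) c2(4) c3(4) by simp_all
    have cl: "closed (path_image c1)" "closed (path_image c2)" "closed (path_image c3)"
      using closed_arc_image [OF c1(1)] closed_arc_image [OF c2(1)] closed_arc_image [OF c3(1)]
      by simp_all
    have n: "p b \<notin> inside (path_image c2 \<union> path_image c3)" "p e \<notin> inside (path_image c1 \<union> path_image c3)"
      using nin V e D cl by blast+
    have "path_image c3 - {p a, p d} \<subseteq> inside (path_image c1 \<union> path_image c2)"
    proof (rule theta_marked_arcs [OF c1(1) c2(1) c3(1) c1(2,3) c2(2,3) c3(2,3)])
      show "p b \<in> path_image c1 - {p a, p d}" "p e \<in> path_image c2 - {p a, p d}"
        using ends [OF e(1)] ends [OF e(3)] pd unfolding c1(4) c2(4) by auto
    qed (use int n in auto)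
    then show ?thesis
      using c1 c2 c3 int n by blast
  qed
  obtain c1 c2 c3 where c: "arc c1" "arc c2" "arc c3" "pathstart c1 = p x" "pathfinish c1 = p z"
      "pathstart c2 = p x" "pathfinish c2 = p z" "pathstart c3 = p x" "pathfinish c3 = p z"
      "path_image c1 = Q x y \<union> Q y z" "path_image c2 = Q x w \<union> Q w z" "path_image c3 = Q x z"
      "path_image c1 \<inter> path_image c2 = {p x, p z}" "path_image c1 \<inter> path_image c3 = {p x, p z}"
      "path_image c2 \<inter> path_image c3 = {p x, p z}"
      "path_image c3 - {p x, p z} \<subseteq> inside (path_image c1 \<union> path_image c2)"
      "p y \<notin> inside (path_image c2 \<union> path_image c3)" "p w \<notin> inside (path_image c1 \<union> path_image c3)"
    using chord [of x y z w] E dist pdist by metis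
  \<comment> \<open>For the diagonal \<open>yw\<close> the four edges are paired differently but
    make up the same closed curve.\<close>
  have in2: "Q y w - {p y, p w} \<subseteq> inside (path_image c1 \<union> path_image c2)"
  proof -
    have "Q y w - {p y, p w} \<subseteq> inside ((Q y x \<union> Q x w) \<union> (Q y z \<union> Q z w))"
      using chord [of y x w z] E dist pdist by metis
    moreover have "(Q y x \<union> Q x w) \<union> (Q y z \<union> Q z w) = path_image c1 \<union> path_image c2"
      unfolding c(10,11) Qsym [of y x] Qsym [of z w] by blast
    ultimately show ?thesis
      by simp
  qed
  obtain d where d: "arc d" "pathstart d = p y" "pathfinish d = p w" "path_image d = Q y w"
    using plane_embedding_edge [OF pc E(6)] unfolding Q_def by blast
  \<comment> \<open>An inner point \<open>q\<close> cuts \<open>yw\<close> into two halves; one of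
    them leads out of whichever domain contains \<open>q\<close>.\<close>
  obtain q where q: "q \<in> Q y w" "q \<noteq> p y" "q \<noteq> p w"
    using nonempty_simple_path_endless [OF arc_imp_simple_path [OF d(1)]] d by auto
  obtain d1 d2 where ds: "arc d1" "pathstart d1 = p y" "pathfinish d1 = q"
    "arc d2" "pathstart d2 = p w" "pathfinish d2 = q"
    "path_image d1 \<union> path_image d2 = Q y w" "path_image d1 \<inter> path_image d2 = {q}"
    using arc_split [OF d(1), of q] q d by metis
  have yw: "p w \<notin> path_image d1" "p y \<notin> path_image d2"
    using ds q pathstart_in_path_image by (metis IntI singletonD)+
  have Qyw: "Q y w \<inter> Q x z = {}" "Q y w \<inter> path_image c1 \<subseteq> {p y}" "Q y w \<inter> path_image c2 \<subseteq> {p w}"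
  proof -
    have E': "(w, y) \<in> parcs G" "(w, x) \<in> parcs G"
      using E sym by blast+
    show "Q y w \<inter> Q x z = {}"
      using apart [OF E(6,5)] dist by blast
    show "Q y w \<inter> path_image c1 \<subseteq> {p y}"
      using meet [OF E(6,8)] meet [OF E(6,2)] dist unfolding c(10) Qsym [of x y] by blast
    show "Q y w \<inter> path_image c2 \<subseteq> {p w}"
      using meet [OF E'] meet [OF E'(1) E(7)] dist unfolding c(11) Qsym [of y w] Qsym [of x w] by blast
  qed
  have "q \<in> inside (path_image c1 \<union> path_image c2)" "q \<notin> path_image c3"
    using q in2 Qyw(1) c(12) by auto
  moreover have "path_image c3 \<inter> inside (path_image c1 \<union> path_image c2) \<noteq> {}"
    using nonempty_simple_path_endless [OF arc_imp_simple_path [OF c(3)]] c by auto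
  \<comment> \<open>\<open>c3\<close> splits the domain of the 4-cycle into two, and
    \<open>q\<close> is not on \<open>c3\<close>.\<close>
  ultimately have "q \<in> inside (path_image c1 \<union> path_image c3) \<union> inside (path_image c2 \<union> path_image c3)"
    using split_inside_simple_closed_curve [OF arc_imp_simple_path [OF c(1)] c(4,5)
        arc_imp_simple_path [OF c(2)] c(6,7) arc_imp_simple_path [OF c(3)] c(8,9) pdist(5) c(13-15)]
    by blast
  then show False
  proof
    assume *: "q \<in> inside (path_image c1 \<union> path_image c3)"
    \<comment> \<open>\<open>yw\<close> meets \<open>c1\<close> only at \<open>p y\<close> and
      \<open>c3\<close> not at all, and \<open>d2\<close> does not contain \<open>p y\<close>; so
      \<open>d2\<close> carries \<open>q\<close> to \<open>p w\<close> within one component.\<close>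
    have "path_image d2 \<subseteq> - (path_image c1 \<union> path_image c3)"
      using ds(7) yw Qyw c(12) by blast
    moreover have "p w \<in> path_image d2" "q \<in> path_image d2"
      using ds pathstart_in_path_image pathfinish_in_path_image by metis+
    ultimately have "connected_component (- (path_image c1 \<union> path_image c3)) q (p w)"
      using connected_arc_image [OF ds(4)] unfolding connected_component_def by blast
    then show False
      using * c(18) inside_same_component by blast
  next
    assume *: "q \<in> inside (path_image c2 \<union> path_image c3)"
    have "path_image d1 \<subseteq> - (path_image c2 \<union> path_image c3)"
      using ds(7) yw Qyw c(12) by blast
    moreover have "p y \<in> path_image d1" "q \<in> path_image d1"
      using ds pathstart_in_path_image pathfinish_in_path_image by metis+
    ultimately have "connected_component (- (path_image c2 \<union> path_image c3)) q (p y)"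
      using connected_arc_image [OF ds(1)] unfolding connected_component_def by blast
    then show False
      using * c(17) inside_same_component by blast
  qed
qed

section \<open>Counting the neighbours of a secure dominating set\<close>

lemma outerplanar_secure_dominating_set_card:
  assumes G: "pair_graph G" "outerplanar G" and n: "card (pverts G) \<ge> 4"
    and S: "secure_dominating_set G S"
  shows "card (pverts G) + 4 \<le> 5 * card S"
proof -
  note fin = pair_graph_facts(1) [OF G(1)] and sym = pair_graph_facts(2) [OF G(1)]
    and ne = pair_graph_facts(5) [OF G(1)]
  note bound = outerplanar_card_two_neighbours [OF G]
  let ?V = "pverts G" and ?E = "parcs G"
  have SV: "S \<subseteq> ?V"
    and guard: "\<And>u. u \<in> ?V - S \<Longrightarrow> \<exists>v\<in>S. (u, v) \<in> ?E \<and> dominating_set G ((S - {v}) \<union> {u})"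
    using S by (auto simp: secure_dominating_set_def dominating_set_def)
  have finS: "finite S"
    using SV fin finite_subset by blast
  \<comment> \<open>the external private neighbours of \<open>v\<close>: the vertices that only \<open>v\<close> can defend\<close>
  define epn where "epn v = {w \<in> ?V - S. (w, v) \<in> ?E \<and> (\<forall>x\<in>S. (w, x) \<in> ?E \<longrightarrow> x = v)}" for v
  define A where "A = (\<Union>v\<in>S. epn v)"
  define B where "B = ?V - S - A"
  have epnD: "w \<in> ?V" "w \<notin> S" "(w, v) \<in> ?E" if "w \<in> epn v" for v w
    using that by (simp_all add: epn_def)
  have B_epn: "u \<notin> epn v" if "u \<in> B" "v \<in> S" for u v
    using that by (simp add: B_def A_def)
  have BD: "u \<in> ?V" "u \<notin> S" if "u \<in> B" for u
    using that by (simp_all add: B_def)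
  \<comment> \<open>\<open>w\<close> is not in the new set and has lost its only neighbour in
    \<open>S\<close>, so the newcomer \<open>u\<close> must dominate it.\<close>
  have defended: "(w, u) \<in> ?E"
    if "dominating_set G ((S - {v}) \<union> {u})" "w \<in> epn v" "w \<noteq> u" for u v w
    using that unfolding dominating_set_def epn_def by blast
  \<comment> \<open>\<open>w\<close> has no defender but \<open>v\<close>, and after replacing
    \<open>v\<close> it must dominate \<open>w'\<close>.\<close>
  have clique: "(w', w) \<in> ?E" if "w \<in> epn v" "w' \<in> epn v" "w \<noteq> w'" for v w w'
  proof -
    have "w \<in> ?V - S"
      using that by (simp add: epn_def)
    then obtain x where x: "x \<in> S" "(w, x) \<in> ?E" "dominating_set G ((S - {x}) \<union> {w})"
      using guard by blast
    have "x = v"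
      using x(1,2) that(1) unfolding epn_def by blast
    then show ?thesis
      using defended [of v w w'] x(3) that by simp
  qed
  have finepn: "finite (epn v)" for v
    using fin by (simp add: epn_def)
  have epn2: "card (epn v) \<le> 2" for v
  proof (rule ccontr)
    assume "\<not> card (epn v) \<le> 2"
    then obtain T where "T \<subseteq> epn v" "card T = 3"
      by (metis obtain_subset_with_card_n not_less_eq_eq numeral_2_eq_2 numeral_3_eq_3)
    then obtain a b c where "a \<in> epn v" "b \<in> epn v" "c \<in> epn v" "a \<noteq> b" "b \<noteq> c" "a \<noteq> c"
      by (auto simp: card_3_iff)
    moreover from this have "(a, v) \<in> ?E" "(b, v) \<in> ?E" "(c, v) \<in> ?E"
      by (simp_all add: epnD)
    ultimately show False
      using outerplanar_no_K4 [OF G, of a b c v] clique by metis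
  qed
  \<comment> \<open>If \<open>v\<close> defends \<open>u\<close>, all its private neighbours are
    adjacent to \<open>u\<close>; two of them, adjacent to each other, would form a
    \<open>K4\<close> with \<open>u\<close> and \<open>v\<close>.\<close>
  have epn_guard: "card (epn v) \<le> 1"
    if "u \<in> B" "(u, v) \<in> ?E" "dominating_set G ((S - {v}) \<union> {u})" "v \<in> S" for u v
  proof (rule ccontr)
    assume "\<not> card (epn v) \<le> 1"
    then have "card (epn v) = 2"
      using epn2 [of v] by linarith
    then obtain a b where "a \<in> epn v" "b \<in> epn v" "a \<noteq> b"
      by (auto simp: card_2_iff)
    moreover from this have "(a, v) \<in> ?E" "(b, v) \<in> ?E" "a \<noteq> u" "b \<noteq> u"
      using that epnD B_epn by blast+
    ultimately show False
      using outerplanar_no_K4 [OF G, of a b u v] clique defended that sym by metis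
  qed
  have second: "\<exists>x\<in>S. x \<noteq> v \<and> (b, x) \<in> ?E" if "b \<in> B" "v \<in> S" for b v
  proof -
    have b: "b \<in> ?V - S" "b \<notin> epn v"
      using that BD B_epn by simp_all
    then obtain y where "y \<in> S" "(b, y) \<in> ?E"
      using guard by blast
    then show ?thesis
      using b by (cases "y = v") (auto simp: epn_def)
  qed
  have cardB: "card B \<le> 2 * (card S - 1)"
  proof (rule bound [OF SV])
    show "\<exists>s\<in>S. \<exists>t\<in>S. s \<noteq> t \<and> (b, s) \<in> ?E \<and> (b, t) \<in> ?E" if b: "b \<in> B" for b
    proof -
      obtain y where "y \<in> S" "(b, y) \<in> ?E"
        using guard BD [OF b] by blast
      then show ?thesis
        using second [OF b] by blast
    qed
  qed (auto simp: B_def)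
  have cardA: "card A \<le> (\<Sum>v\<in>S. card (epn v))"
    unfolding A_def by (rule card_UN_le [OF finS])
  have "?V = S \<union> A \<union> B"
    using SV epnD(1) by (auto simp: B_def A_def)
  then have cardV: "card ?V \<le> card S + card A + card B"
    using card_Un_le [of "S \<union> A" B] card_Un_le [of S A] by simp
  have sum2: "(\<Sum>v\<in>T. card (epn v)) \<le> 2 * card T" for T
    using sum_bounded_above [of T "\<lambda>v. card (epn v)" 2] epn2 by (simp add: mult.commute)
  \<comment> \<open>An empty \<open>S\<close> would leave no vertices at all; with \<open>S\<close>
    nonempty the truncated \<open>card S - 1\<close> is exact.\<close>
  have S0: "card S \<noteq> 0"
    using cardV cardA sum2 [of S] cardB n by auto
  show ?thesis
  proof (cases "card A \<le> 2 * (card S - 1) \<or> B = {}")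
    \<comment> \<open>With \<open>k = card S\<close>, either
      \<open>n \<le> k + 2 * (k - 1) + 2 * (k - 1) = 5 * k - 4\<close>, or \<open>B\<close> is empty
      and \<open>n \<le> 3 * k\<close>, where \<open>n \<ge> 4\<close> forces
      \<open>k \<ge> 2\<close>.\<close>
    case True
    then have "card A \<le> 2 * (card S - 1) \<or> card B = 0"
      by auto
    then show ?thesis
      using cardV cardB cardA sum2 [of S] n S0 by presburger
  next
    case False
    then obtain b0 where b0: "b0 \<in> B"
      by blast
    then obtain v where v: "v \<in> S" "(b0, v) \<in> ?E" "dominating_set G ((S - {v}) \<union> {b0})"
      using guard BD by blast
    have rem: "(\<Sum>x\<in>S. card (epn x)) = card (epn v) + (\<Sum>x\<in>S - {v}. card (epn x))"
      using finS v by (simp add: sum.remove)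
    have cS: "card (S - {v}) = card S - 1"
      using v finS by simp
    \<comment> \<open>As a defender of \<open>b0\<close>, \<open>v\<close> has at most one private
      neighbour. Since the total exceeds \<open>2 * (card S - 1)\<close>, it has exactly one, and
      the sum over the other vertices is maximal.\<close>
    have ev: "card (epn v) = 1" and full: "(\<Sum>x\<in>S - {v}. card (epn x)) = 2 * (card S - 1)"
      using epn_guard [OF b0 v(2,3,1)] sum2 [of "S - {v}"] cS rem cardA False by linarith+
    have others: "card (epn x) = 2" if "x \<in> S" "x \<noteq> v" for x
    proof -
      have "(\<Sum>y\<in>S - {v}. card (epn y)) = card (epn x) + (\<Sum>y\<in>S - {v} - {x}. card (epn y))"
        using finS that by (simp add: sum.remove)
      moreover have "card (S - {v} - {x}) = card S - 2" "2 \<le> card S"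
      proof -
        have "card {x, v} \<le> card S"
          using finS that v by (intro card_mono) auto
        then show "2 \<le> card S"
          using that by simp
        show "card (S - {v} - {x}) = card S - 2"
          using finS that v by simp
      qed
      ultimately show ?thesis
        using sum2 [of "S - {v} - {x}"] full epn2 [of x] by linarith
    qed
    from ev obtain w where w: "epn v = {w}"
      by (auto simp: card_1_singleton_iff)
    then have wV: "w \<in> ?V" "w \<notin> S" "w \<in> A"
      using v unfolding epn_def A_def by blast+
    \<comment> \<open>Only \<open>v\<close> has fewer than two private neighbours, so
      \<open>v\<close> defends every \<open>b\<close>; after that move only \<open>b\<close> can
      dominate \<open>w\<close>.\<close>
    have Badj: "(b, v) \<in> ?E" "(b, w) \<in> ?E" if b: "b \<in> B" for b
    proof -
      obtain x where x: "x \<in> S" "(b, x) \<in> ?E" "dominating_set G ((S - {x}) \<union> {b})"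
        using guard BD [OF b] by blast
      then have "x = v"
        using epn_guard [OF b x(2,3,1)] others by fastforce
      moreover have "w \<noteq> b"
        using b wV by (auto simp: B_def)
      ultimately show "(b, v) \<in> ?E" "(b, w) \<in> ?E"
        using x defended [of v b w] w sym by auto
    qed
    have vw: "v \<noteq> w"
      using v wV by blast
    have BV: "B \<subseteq> ?V" "\<And>x. x \<in> S \<Longrightarrow> x \<notin> B" "w \<notin> B"
      using wV by (auto simp: B_def)
    \<comment> \<open>All of \<open>B\<close> is adjacent to both \<open>v\<close> and
      \<open>w\<close>, so \<open>{v, w}\<close> can take the place of \<open>S\<close> in the
      bound.\<close>
    have "card B \<le> 2 * (card {v, w} - 1)"
    proof (rule bound)
      show "\<exists>s\<in>{v, w}. \<exists>t\<in>{v, w}. s \<noteq> t \<and> (b, s) \<in> ?E \<and> (b, t) \<in> ?E" if "b \<in> B" for b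
        using Badj [OF that] vw by blast
    qed (use v wV SV BV in auto)
    then have B2: "card B \<le> 2"
      using vw by simp
    obtain v' where v': "v' \<in> S" "v' \<noteq> v"
      using second [OF b0 v(1)] by blast
    show ?thesis
    \<comment> \<open>Now \<open>n \<le> k + (2 * k - 1) + 2 = 3 * k + 1\<close> with
      \<open>k = card S\<close>. This suffices from \<open>k = 3\<close> on; for
      \<open>k = 2\<close> it is off by one, and \<open>card B \<le> 1\<close> makes up for
      it.\<close>
    proof (cases "card S \<ge> 3")
      case True
      then show ?thesis
        using cardV cardA rem ev full B2 by linarith
    next
      case False
      have sub: "{v, v'} \<subseteq> S"
        using v v' by blast
      have "card {v, v'} = 2"
        using v' by simp
      then have "card {v, v'} = card S"
        using False card_mono [OF finS sub] by linarith
      then have S2: "S = {v, v'}"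
        using card_subset_eq [OF finS sub] by simp
      have adj': "(b, v') \<in> ?E" if "b \<in> B" for b
        using second [OF that v(1)] unfolding S2 by auto
      \<comment> \<open>Two vertices of \<open>B\<close> would have the three common neighbours
        \<open>v\<close>, \<open>w\<close>, \<open>v'\<close>, a \<open>K_{2,3}\<close>; the bound
        with \<open>{b, c}\<close> in the role of \<open>S\<close> excludes this.\<close>
      have "card B \<le> 1"
      proof (rule ccontr)
        assume "\<not> card B \<le> 1"
        then obtain T where "T \<subseteq> B" "card T = 2"
          by (metis obtain_subset_with_card_n not_less_eq_eq One_nat_def numeral_2_eq_2)
        then obtain b c where bc: "b \<in> B" "c \<in> B" "b \<noteq> c"
          by (auto simp: card_2_iff)
        have adj: "(x, b) \<in> ?E \<and> (x, c) \<in> ?E" if "x \<in> {v, w, v'}" for x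
          using that Badj [OF bc(1)] Badj [OF bc(2)] adj' [OF bc(1)] adj' [OF bc(2)] sym by blast
        have "card {v, w, v'} \<le> 2 * (card {b, c} - 1)"
        proof (rule bound)
          show "\<exists>s\<in>{b, c}. \<exists>t\<in>{b, c}. s \<noteq> t \<and> (x, s) \<in> ?E \<and> (x, t) \<in> ?E" if "x \<in> {v, w, v'}" for x
            using adj [OF that] bc by blast
        qed (use v v' wV SV BV bc in auto)
        moreover have "w \<noteq> v'"
          using v' wV by blast
        then have "card {v, w, v'} = 3"
          using v' vw by simp
        ultimately show False
          using bc by simp
      qed
      then show ?thesis
        using cardV cardA rem ev full S2 v' by simp
    qed
  qed
qed

section \<open>The secure domination number as an attained minimum\<close>

lemma finite_secure_dominating_sets:
  assumes "pair_graph G"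
  shows "finite {S. secure_dominating_set G S}"
proof (rule finite_subset)
  show "{S. secure_dominating_set G S} \<subseteq> Pow (pverts G)"
    by (auto simp: secure_dominating_set_def dominating_set_def)
qed (simp add: pair_graph_facts(1) [OF assms])

lemma secure_domination_number_le:
  assumes "pair_graph G" "secure_dominating_set G S"
  shows "secure_domination_number G \<le> card S"
  unfolding secure_domination_number_def
  using finite_secure_dominating_sets [OF assms(1)] assms(2) by (intro Min_le) auto

lemma outerplanar_secure_domination_number_ge:
  assumes "pair_graph G" "outerplanar G" "card (pverts G) \<ge> 4"
  shows "card (pverts G) + 4 \<le> 5 * secure_domination_number G"
proof -
  let ?F = "{S. secure_dominating_set G S}"
  have "pverts G \<in> ?F"
    by (auto simp: secure_dominating_set_def dominating_set_def)
  then have "secure_domination_number G \<in> card ` ?F"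
    unfolding secure_domination_number_def
    using finite_secure_dominating_sets [OF assms(1)] by (intro Min_in) auto
  then show ?thesis
    using outerplanar_secure_dominating_set_card [OF assms] by auto
qed

section \<open>The extremal graphs\<close>

text \<open>Negated, \<open>(x - a) * (x - b)\<close> is the height of the chord over
  \<open>[a, b]\<close> above the parabola. A chord extending beyond \<open>[c, d]\<close> on both
  sides is strictly higher there; if one end is shared, the two chords meet only in it.\<close>

lemma parabola_chords_nested:
  fixes a b c d x :: real
  assumes "a \<le> c" "d \<le> b" "c \<le> x" "x \<le> d" "(x - a) * (x - b) = (x - c) * (x - d)"
    and "a \<noteq> c \<or> b \<noteq> d"
  shows "x = a \<and> a = c \<or> x = b \<and> b = d"
proof -
  consider "a = c" | "b = d" | "a < c" "d < b"
    using assms by linarith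
  then show ?thesis
  proof cases
    case 1
    with assms(5) have "(x - a) * (d - b) = 0"
      by (simp add: algebra_simps)
    then show ?thesis
      using 1 assms(6) by auto
  next
    case 2
    with assms(5) have "(x - b) * (c - a) = 0"
      by (simp add: algebra_simps)
    then show ?thesis
      using 2 assms(6) by auto
  next
    case 3
    have "0 \<le> (c - a) * (d - x)" "0 \<le> (b - d) * (x - c)" "0 < (c - a) * (b - d)"
      using 3 assms by auto
    moreover have "(c - a) * (d - x) + (b - d) * (x - c) + (c - a) * (b - d) = 0"
      using assms(5) by (simp add: algebra_simps)
    ultimately show ?thesis
      by linarith
  qed
qed

definition parabola_point :: "nat \<Rightarrow> complex" where
  "parabola_point j = Complex (real j) (real j ^ 2)"

lemma parabola_point_eq_iff: "parabola_point i = parabola_point j \<longleftrightarrow> i = j"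
  by (auto simp: parabola_point_def)

lemma parabola_chord:
  assumes "z \<in> closed_segment (parabola_point a) (parabola_point b)" "a \<le> b"
  shows "real a \<le> Re z" "Re z \<le> real b" "Re z ^ 2 - Im z = (Re z - real a) * (Re z - real b)"
proof -
  obtain u where u: "0 \<le> u" "u \<le> 1" "z = (1 - u) *\<^sub>R parabola_point a + u *\<^sub>R parabola_point b"
    using assms(1) by (auto simp: in_segment)
  have re: "Re z = real a + u * (real b - real a)" and im: "Im z = real a ^ 2 + u * (real b ^ 2 - real a ^ 2)"
    unfolding u(3) by (simp_all add: parabola_point_def algebra_simps)
  have "0 \<le> u * (real b - real a)" "0 \<le> (1 - u) * (real b - real a)"
    using u assms(2) by simp_all
  then show "real a \<le> Re z" "Re z \<le> real b"
    unfolding re by (simp_all add: algebra_simps)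
  show "Re z ^ 2 - Im z = (Re z - real a) * (Re z - real b)"
    unfolding re im by (simp add: algebra_simps power2_eq_square)
qed

text \<open>This convex set contains all chords, so everything below the parabola will belong to the
  outer face.\<close>

lemma convex_parabola_epigraph: "convex {z. Re z ^ 2 \<le> Im z}"
proof (rule convexI)
  fix z w :: complex and u v :: real
  assume z: "z \<in> {z. Re z ^ 2 \<le> Im z}" and w: "w \<in> {z. Re z ^ 2 \<le> Im z}" and uv: "0 \<le> u" "0 \<le> v" "u + v = 1"
  have v: "v = 1 - u"
    using uv by simp
  have "(u * Re z + v * Re w) ^ 2 = u * Re z ^ 2 + v * Re w ^ 2 - u * v * (Re z - Re w) ^ 2"
    unfolding v by (simp add: algebra_simps power2_eq_square)
  also have "\<dots> \<le> u * Re z ^ 2 + v * Re w ^ 2"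
    using uv by simp
  also have "\<dots> \<le> u * Im z + v * Im w"
    using z w uv by (intro add_mono mult_left_mono) auto
  finally show "u *\<^sub>R z + v *\<^sub>R w \<in> {z. Re z ^ 2 \<le> Im z}"
    by simp
qed

text \<open>
  Points on a parabola are in convex position, so chords meet only if their endpoints interleave,
  and every vertex can be reached from below the parabola.
\<close>

lemma noncrossing_imp_outerplanar:
  fixes G :: "nat pair_pre_digraph"
  assumes verts: "\<And>a b. (a, b) \<in> parcs G \<Longrightarrow> a \<in> pverts G \<and> b \<in> pverts G"
    and loop: "\<And>a b. (a, b) \<in> parcs G \<Longrightarrow> a \<noteq> b"
    and sym: "\<And>a b. (a, b) \<in> parcs G \<Longrightarrow> (b, a) \<in> parcs G"
    and nocross: "\<And>a b c d. (a, b) \<in> parcs G \<Longrightarrow> (c, d) \<in> parcs G \<Longrightarrow> a < c \<Longrightarrow> c < b \<Longrightarrow> b < d \<Longrightarrow> False"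
  shows "outerplanar G"
proof -
  let ?p = parabola_point
  \<comment> \<open>\<open>Min\<close> and \<open>Max\<close> give one curve per undirected edge,
    directed from left to right.\<close>
  define c where "c e = linepath (?p (Min e)) (?p (Max e))" for e
  have edge: thesis if e: "e \<in> uedges G"
    and *: "\<And>a b. \<lbrakk>(a, b) \<in> parcs G; a < b; e = {a, b}; c e = linepath (?p a) (?p b)\<rbrakk> \<Longrightarrow> thesis" for e thesis
  proof -
    obtain u v where uv: "(u, v) \<in> parcs G" "e = {u, v}"
      using e unfolding uedges_def by blast
    show thesis
    proof (cases "u < v")
      case True
      then show thesis
        using uv * [of u v] by (simp add: c_def)
    next
      case False
      then have "v < u"
        using loop [OF uv(1)] by simp
      then show thesis
        using uv * [of v u] sym by (simp add: c_def insert_commute)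
    qed
  qed
  have meet: "z \<in> ?p ` ({a, b} \<inter> {a', b'})"
    if "(a, b) \<in> parcs G" "(a', b') \<in> parcs G" "a < b" "a' < b'" "{a, b} \<noteq> {a', b'}"
      and z: "z \<in> closed_segment (?p a) (?p b)" "z \<in> closed_segment (?p a') (?p b')" for a b a' b' z
  proof -
    note za = parabola_chord [OF z(1) less_imp_le [OF that(3)]]
    note zb = parabola_chord [OF z(2) less_imp_le [OF that(4)]]
    have eq: "(Re z - real a) * (Re z - real b) = (Re z - real a') * (Re z - real b')"
      using za(3) zb(3) by simp
    have at: "z = ?p j" if "Re z = real j" "j = a \<or> j = b" for j
      using za(3) that by (auto simp: parabola_point_def complex_eq_iff)
    have ne: "a \<noteq> a' \<or> b \<noteq> b'"
      using that(5) by auto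
    have "\<not> (a < a' \<and> a' < b \<and> b < b')" "\<not> (a' < a \<and> a < b' \<and> b' < b)"
      using nocross that(1,2) by blast+
    \<comment> \<open>Intervals that do not interleave are nested or share at most an end.\<close>
    then consider "b \<le> a'" | "b' \<le> a" | "a \<le> a'" "b' \<le> b" | "a' \<le> a" "b \<le> b'"
      by linarith
    then show ?thesis
    proof cases
      case 1
      then have "b = a'" "Re z = real b"
        using za zb by linarith+
      then show ?thesis
        using at [of b] by simp
    next
      case 2
      then have "b' = a" "Re z = real a"
        using za zb by linarith+
      then show ?thesis
        using at [of a] by simp
    next
      case 3
      then have "Re z = real a \<and> real a = real a' \<or> Re z = real b \<and> real b = real b'"
        using za zb eq ne by (intro parabola_chords_nested) auto
      then show ?thesis
        using at by auto
    next
      case 4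
      then have "Re z = real a' \<and> real a' = real a \<or> Re z = real b' \<and> real b' = real b"
        using za zb eq ne by (intro parabola_chords_nested) auto
      then show ?thesis
        using at by auto
    qed
  qed
  have emb: "plane_embedding G ?p c"
    unfolding plane_embedding_def
  proof (intro conjI ballI impI)
    show "inj_on ?p (pverts G)"
      by (simp add: inj_on_def parabola_point_eq_iff)
  next
    fix e assume "e \<in> uedges G"
    then show "arc (c e)"
      by (rule edge) (simp add: parabola_point_eq_iff arc_linepath)
  next
    fix e assume "e \<in> uedges G"
    then show "{pathstart (c e), pathfinish (c e)} = ?p ` e"
      by (rule edge) simp
  next
    fix e assume "e \<in> uedges G"
    then show "path_image (c e) \<inter> ?p ` pverts G = ?p ` e"
    proof (rule edge)
      fix a b assume ab: "(a, b) \<in> parcs G" "a < b" "e = {a, b}" "c e = linepath (?p a) (?p b)"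
      have "j = a \<or> j = b" if "?p j \<in> closed_segment (?p a) (?p b)" for j
        using parabola_chord(3) [OF that] ab(2) by (simp add: parabola_point_def)
      then show ?thesis
        using ab verts [OF ab(1)] by auto
    qed
  next
    fix e f assume "e \<in> uedges G" "f \<in> uedges G" "e \<noteq> f"
    from this(1) show "path_image (c e) \<inter> path_image (c f) \<subseteq> ?p ` (e \<inter> f)"
    proof (rule edge)
      fix a b assume ab: "(a, b) \<in> parcs G" "a < b" "e = {a, b}" "c e = linepath (?p a) (?p b)"
      from \<open>f \<in> uedges G\<close> show ?thesis
      proof (rule edge)
        fix a' b' assume "(a', b') \<in> parcs G" "a' < b'" "f = {a', b'}" "c f = linepath (?p a') (?p b')"
        then show ?thesis
          using ab \<open>e \<noteq> f\<close> meet [of a b a' b'] by auto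
      qed
    qed
  qed
  let ?P = "{z. Re z ^ 2 \<le> Im z}" and ?D = "drawing G ?p c"
  have "z \<in> ?P" if "z \<in> path_image (c e)" "e \<in> uedges G" for z e
    using that(2)
  proof (rule edge)
    fix a b assume ab: "a < b" "c e = linepath (?p a) (?p b)"
    then have z: "z \<in> closed_segment (?p a) (?p b)"
      using that(1) by simp
    note z = parabola_chord [OF z less_imp_le [OF ab(1)]]
    have "0 \<le> (Re z - real a) * (real b - Re z)"
      using z by simp
    then show "z \<in> ?P"
      using z(3) by (simp add: algebra_simps)
  qed
  then have "?D \<subseteq> ?P"
    by (auto simp: drawing_def parabola_point_def)
  then have out: "- ?P \<subseteq> outside ?D"
    by (rule outside_subset_convex [OF convex_parabola_epigraph])
  have "?p j \<in> frontier (outside ?D)" if "j \<in> pverts G" for j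
  proof -
    \<comment> \<open>Points just below the parabola approach \<open>?p j\<close>, and they lie in
      the outer face.\<close>
    have "?p j \<in> closure (- ?P)"
    proof (unfold closure_approachable, intro allI impI)
      fix e :: real assume "0 < e"
      then have "?p j - \<i> * of_real (e / 2) \<in> - ?P \<and> dist (?p j - \<i> * of_real (e / 2)) (?p j) < e"
        by (simp add: dist_norm norm_mult parabola_point_def)
      then show "\<exists>y\<in>- ?P. dist y (?p j) < e"
        by blast
    qed
    then have "?p j \<in> closure (outside ?D)"
      using closure_mono [OF out] by blast
    moreover have "?p j \<notin> interior (outside ?D)"
      using that interior_subset outside_no_overlap [of ?D] unfolding drawing_def by blast
    ultimately show ?thesis
      by (simp add: frontier_def)
  qed
  then show ?thesis
    using emb unfolding outerplanar_def by blast
qed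

section \<open>A cactus attaining the bound\<close>

text \<open>
  \<open>k\<close> four-cycles through the vertex \<open>0\<close>; the vertex \<open>5 * i + 2\<close> opposite to \<open>0\<close> on the \<open>i\<close>-th of
  them also lies on a pendant triangle.
\<close>

definition cactus_arcs :: "nat \<Rightarrow> (nat \<times> nat) set" where
  "cactus_arcs k = (\<Union>i<k. {(0, 5*i+1), (5*i+1, 5*i+2), (5*i+2, 5*i+3), (5*i+3, 5*i+4),
     (5*i+2, 5*i+4), (5*i+2, 5*i+5), (0, 5*i+5)})"

definition cactus :: "nat \<Rightarrow> nat pair_pre_digraph" where
  "cactus k = \<lparr>pverts = {..5 * k}, parcs = cactus_arcs k \<union> (cactus_arcs k)\<inverse>\<rparr>"

lemma cactus_arcsE:
  assumes "(a, b) \<in> cactus_arcs k"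
  obtains i where "i < k" "a = 0 \<and> b = 5*i+1 \<or> a = 5*i+1 \<and> b = 5*i+2 \<or> a = 5*i+2 \<and> b = 5*i+3 \<or>
    a = 5*i+3 \<and> b = 5*i+4 \<or> a = 5*i+2 \<and> b = 5*i+4 \<or> a = 5*i+2 \<and> b = 5*i+5 \<or> a = 0 \<and> b = 5*i+5"
  using assms unfolding cactus_arcs_def by auto

lemma cactus_arcs_bounds: "(a, b) \<in> cactus_arcs k \<Longrightarrow> a < b \<and> b \<le> 5 * k"
  by (erule cactus_arcsE) (elim disjE conjE; simp)

text \<open>Since \<open>c > 0\<close>, the arc \<open>(c, d)\<close> stays within the block
  \<open>5*j+1, ..., 5*j+5\<close>. An arc from \<open>0\<close> ends at the first or last vertex of
  a block, so never strictly between \<open>c\<close> and \<open>d\<close>; otherwise both arcs lie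
  in the same block, which leaves a finite check.\<close>

lemma cactus_arcs_noncrossing:
  assumes "(a, b) \<in> cactus_arcs k" "(c, d) \<in> cactus_arcs k" "a < c" "c < b" "b < d"
  shows False
proof -
  from assms(1) obtain i where i: "a = 0 \<and> b = 5*i+1 \<or> a = 5*i+1 \<and> b = 5*i+2 \<or> a = 5*i+2 \<and> b = 5*i+3 \<or>
    a = 5*i+3 \<and> b = 5*i+4 \<or> a = 5*i+2 \<and> b = 5*i+4 \<or> a = 5*i+2 \<and> b = 5*i+5 \<or> a = 0 \<and> b = 5*i+5"
    by (rule cactus_arcsE)
  from assms(2) obtain j where j: "c = 0 \<and> d = 5*j+1 \<or> c = 5*j+1 \<and> d = 5*j+2 \<or> c = 5*j+2 \<and> d = 5*j+3 \<or>
    c = 5*j+3 \<and> d = 5*j+4 \<or> c = 5*j+2 \<and> d = 5*j+4 \<or> c = 5*j+2 \<and> d = 5*j+5 \<or> c = 0 \<and> d = 5*j+5"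
    by (rule cactus_arcsE)
  show False
  proof -
    have c: "5*j+1 \<le> c" "d \<le> 5*j+5" "c \<noteq> 0"
      using j assms(3) by auto
    show False
    proof (cases "a = 0")
      case True
      then have "b = 5*i+1 \<or> b = 5*i+5"
        using i by auto
      moreover have "5*j+1 < b" "b < 5*j+5"
        using c assms by linarith+
      ultimately show False
        by presburger
    next
      case False
      then have a: "5*i+1 \<le> a" "b \<le> 5*i+5"
        using i by auto
      have "i = j"
        using a c assms(3-5) by linarith
      then show False
        using i j False c(3) assms(3-5) by (elim disjE conjE; simp)
    qed
  qed
qed

lemma pair_graph_cactus: "pair_graph (cactus k)"
proof -
  have fin: "finite (cactus_arcs k)"
    by (simp add: cactus_arcs_def)
  show ?thesis
  proof
    show "symmetric (with_proj (cactus k))"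
      by (auto simp: symmetric_def cactus_def intro: symI)
  qed (use fin in \<open>auto simp: cactus_def dest: cactus_arcs_bounds\<close>)
qed

lemma outerplanar_cactus: "outerplanar (cactus k)"
proof (rule noncrossing_imp_outerplanar)
  fix a b c d assume *: "(a, b) \<in> parcs (cactus k)" "(c, d) \<in> parcs (cactus k)" "a < c" "c < b" "b < d"
  then have "(a, b) \<in> cactus_arcs k" "(c, d) \<in> cactus_arcs k"
    using cactus_arcs_bounds [of b a k] cactus_arcs_bounds [of d c k] by (auto simp: cactus_def)
  then show False
    using * cactus_arcs_noncrossing by blast
qed (auto simp: cactus_def dest: cactus_arcs_bounds)

lemma cactus_vertexE:
  assumes "w \<in> pverts (cactus k)"
  obtains "w = 0" | i where "i < k" "w = 5*i+1 \<or> w = 5*i+2 \<or> w = 5*i+3 \<or> w = 5*i+4 \<or> w = 5*i+5"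
proof (cases w)
  case (Suc m)
  then have "m div 5 < k"
    using assms by (auto simp: cactus_def)
  moreover have "w = 5*(m div 5)+1 \<or> w = 5*(m div 5)+2 \<or> w = 5*(m div 5)+3 \<or> w = 5*(m div 5)+4 \<or> w = 5*(m div 5)+5"
    using Suc by presburger
  ultimately show thesis
    using that by blast
qed (use that in blast)

lemma cactus_adj:
  assumes "i < k"
  shows "(0, 5*i+1) \<in> parcs (cactus k)" "(5*i+1, 0) \<in> parcs (cactus k)"
    "(0, 5*i+5) \<in> parcs (cactus k)" "(5*i+5, 0) \<in> parcs (cactus k)"
    "(5*i+1, 5*i+2) \<in> parcs (cactus k)" "(5*i+3, 5*i+2) \<in> parcs (cactus k)"
    "(5*i+4, 5*i+2) \<in> parcs (cactus k)" "(5*i+5, 5*i+2) \<in> parcs (cactus k)"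
    "(5*i+2, 5*i+3) \<in> parcs (cactus k)" "(5*i+2, 5*i+4) \<in> parcs (cactus k)"
    "(5*i+3, 5*i+4) \<in> parcs (cactus k)" "(5*i+4, 5*i+3) \<in> parcs (cactus k)"
  using assms by (auto simp: cactus_def cactus_arcs_def)

text \<open>\<open>0\<close> defends \<open>5*i+1\<close> and \<open>5*i+5\<close>: the vertices
  \<open>5*i+2\<close> still dominate all but \<open>0\<close>, and the new vertex dominates
  \<open>0\<close>. \<open>5*i+2\<close> defends \<open>5*i+3\<close> and \<open>5*i+4\<close>: then
  \<open>0\<close> and the new vertex share block \<open>i\<close>.\<close>

lemma secure_dominating_set_cactus:
  "secure_dominating_set (cactus k) (insert 0 ((\<lambda>i. 5*i+2) ` {..<k}))" (is "secure_dominating_set ?G ?S")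
proof -
  have SV: "?S \<subseteq> pverts ?G"
    by (auto simp: cactus_def)
  \<comment> \<open>Stated for any \<open>T\<close> containing the vertices \<open>5*i+2\<close>, so
    that it covers both \<open>?S\<close> and the set in which \<open>0\<close> has been
    exchanged.\<close>
  have hub: "\<exists>v\<in>T. (w, v) \<in> parcs ?G"
    if "w \<in> pverts ?G - T" "(\<lambda>i. 5*i+2) ` {..<k} \<subseteq> T" "w \<noteq> 0" for w T
    using that(1)
  proof (elim DiffE, elim cactus_vertexE)
    fix i assume i: "i < k" "w = 5*i+1 \<or> w = 5*i+2 \<or> w = 5*i+3 \<or> w = 5*i+4 \<or> w = 5*i+5" "w \<notin> T"
    have "5*i+2 \<in> T"
      using that(2) i by blast
    then show ?thesis
      using i cactus_adj [OF i(1)] by (intro bexI [of _ "5*i+2"]) auto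
  qed (use that in auto)
  have "dominating_set ?G ?S"
    unfolding dominating_set_def using SV hub [of _ ?S] by blast
  moreover have "\<exists>v\<in>?S. (u, v) \<in> parcs ?G \<and> dominating_set ?G ((?S - {v}) \<union> {u})"
    if u: "u \<in> pverts ?G - ?S" for u
  proof -
    from u obtain i where i: "i < k" "u = 5*i+1 \<or> u = 5*i+2 \<or> u = 5*i+3 \<or> u = 5*i+4 \<or> u = 5*i+5"
      by (auto elim: cactus_vertexE)
    note adj = cactus_adj [OF i(1)]
    have "u \<noteq> 5*i+2"
      using u i by blast
    with i consider "u = 5*i+1 \<or> u = 5*i+5" | "u = 5*i+3 \<or> u = 5*i+4"
      by blast
    then show ?thesis
    proof cases
      case 1
      let ?T = "(?S - {0}) \<union> {u}"
      have "\<exists>v\<in>?T. (w, v) \<in> parcs ?G" if w: "w \<in> pverts ?G - ?T" for w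
      proof (cases "w = 0")
        case True
        then show ?thesis
          using 1 adj by blast
      next
        case False
        then show ?thesis
          using hub [OF w] by auto
      qed
      then have "dominating_set ?G ?T"
        unfolding dominating_set_def using SV u by blast
      moreover have "(u, 0) \<in> parcs ?G"
        using 1 adj by blast
      ultimately show ?thesis
        by blast
    next
      case 2
      let ?T = "(?S - {5*i+2}) \<union> {u}"
      have "\<exists>v\<in>?T. (w, v) \<in> parcs ?G" if w: "w \<in> pverts ?G - ?T" for w
      proof -
        have "w \<noteq> 0"
          using w by auto
        with w obtain j where j: "j < k" "w = 5*j+1 \<or> w = 5*j+2 \<or> w = 5*j+3 \<or> w = 5*j+4 \<or> w = 5*j+5"
          by (auto elim: cactus_vertexE)
        show ?thesis
        proof (cases "j = i")
          case True
          have "w \<noteq> u"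
            using w by auto
          \<comment> \<open>In block \<open>i\<close>, \<open>0\<close> dominates
            \<open>5*i+1\<close> and \<open>5*i+5\<close>, while \<open>u\<close> dominates the rest
            of its triangle.\<close>
          with 2 j(2) adj have "(w, 0) \<in> parcs ?G \<or> (w, u) \<in> parcs ?G"
            unfolding True by (elim disjE) simp_all
          moreover have "0 \<in> ?T" "u \<in> ?T"
            by auto
          ultimately show ?thesis
            by blast
        next
          case False
          then have "5*j+2 \<in> ?T" "w \<noteq> 5*j+2"
            using w j(1) by auto
          then show ?thesis
            using j(2) cactus_adj [OF j(1)] by blast
        qed
      qed
      then have "dominating_set ?G ?T"
        unfolding dominating_set_def using SV u by blast
      moreover have "(u, 5*i+2) \<in> parcs ?G" "5*i+2 \<in> ?S"
        using 2 adj i(1) by blast+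
      ultimately show ?thesis
        by blast
    qed
  qed
  ultimately show ?thesis
    unfolding secure_dominating_set_def by blast
qed

theorem theorem1:
  shows "(\<forall>G :: 'a pair_pre_digraph.
            pair_graph G \<and> outerplanar G \<and> card (pverts G) \<ge> 4 \<longrightarrow>
              real (secure_domination_number G) \<ge> (real (card (pverts G)) + 4) / 5)
       \<and> (\<forall>k\<ge>2. \<exists>G :: nat pair_pre_digraph.
            pair_graph G \<and> outerplanar G \<and> card (pverts G) = 5 * k + 1 \<and>
              real (secure_domination_number G) = (real (card (pverts G)) + 4) / 5 \<and>
              secure_domination_number G = k + 1)"
proof (intro conjI allI impI)
  fix G :: "'a pair_pre_digraph"
  assume "pair_graph G \<and> outerplanar G \<and> card (pverts G) \<ge> 4"
  then have "card (pverts G) + 4 \<le> 5 * secure_domination_number G"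
    using outerplanar_secure_domination_number_ge by blast
  then have "real (card (pverts G) + 4) \<le> real (5 * secure_domination_number G)"
    by (simp only: of_nat_le_iff)
  then show "real (secure_domination_number G) \<ge> (real (card (pverts G)) + 4) / 5"
    by simp
next
  fix k :: nat
  assume "2 \<le> k"
  have n: "card (pverts (cactus k)) = 5 * k + 1"
    by (simp add: cactus_def)
  \<comment> \<open>For \<open>n = 5 * k + 1\<close> the general bound reads
    \<open>5 * k + 5 \<le> 5 * secure_domination_number (cactus k)\<close>; \<open>k \<ge> 2\<close>
    provides its hypothesis \<open>n \<ge> 4\<close>.\<close>
  then have "secure_domination_number (cactus k) \<ge> k + 1"
    using outerplanar_secure_domination_number_ge [OF pair_graph_cactus outerplanar_cactus, of k] \<open>2 \<le> k\<close>
    by simp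
  moreover have "secure_domination_number (cactus k) \<le> k + 1"
  proof -
    have "card (insert 0 ((\<lambda>i. 5*i+2) ` {..<k})) \<le> Suc (card ((\<lambda>i. 5*i+2) ` {..<k}))"
      by (simp add: card_insert_if)
    also have "\<dots> \<le> k + 1"
      using card_image_le [of "{..<k}" "\<lambda>i. 5*i+2"] by simp
    finally show ?thesis
      using secure_domination_number_le [OF pair_graph_cactus secure_dominating_set_cactus [of k]]
      by linarith
  qed
  ultimately have g: "secure_domination_number (cactus k) = k + 1"
    by simp
  show "\<exists>G :: nat pair_pre_digraph. pair_graph G \<and> outerplanar G \<and> card (pverts G) = 5 * k + 1 \<and>
      real (secure_domination_number G) = (real (card (pverts G)) + 4) / 5 \<and>
      secure_domination_number G = k + 1"
  proof (intro exI conjI)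
    show "real (secure_domination_number (cactus k)) = (real (card (pverts (cactus k))) + 4) / 5"
      unfolding g n by simp
  qed (fact pair_graph_cactus outerplanar_cactus n g)+
qed

end
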